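(* Let $(e_i)$ be a normalized, $1$-spreading, bimonotone basis for a Banach space $X$ which is not weakly null. Let $S$ be the summing functional $S(\sum_i a_i e_i)=\sum_i a_i$ (which is bounded on $X$), let $(d_i)=(e_1, e_2-e_1, e_3-e_2,\ldots)$ be the difference sequence, and let $(e_i^* )$ be the functionals biorthogonal to $(e_i)$. Then: \begin{enumerate} \item[a)] If $(x_i)$ is a normalized block basis of $(e_i)$ with $S(x_i)=0$ for all $i$, then $(x_i)$ is suppression $1$-unconditional. \item[b)] $(d_i)$ is a skipped unconditional basis for $X$. \item[c)] $(e_i)$ is boundedly complete if and only if $c_0$ does not embed isomorphically into $X$. \item[d)] $(d_i)$ is shrinking if and only if $\ell_1$ does not embed isomorphically into $X$. \item[e)] $\ell_1$ does not embed isomorphically into $X$ if and only if $X^*=\mathbb{R}S\oplus [(e_i^* )]$. \item[f)] Neither $c_0$ nor $\ell_1$ embeds isomorphically into $X$ if and only if $X$ is quasi-reflexive of order $1$. \end{enumerate}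
   Context: Banach spaces are real and $[\,\cdot\,]$ denotes closed linear span. A basic sequence $(e_i)$ is $1$-spreading if it is isometrically equivalent ($1$-equivalent) to each of its subsequences: $\|\sum_i a_i e_i\|=\|\sum_i a_i e_{n_i}\|$ for all finitely supported scalars $(a_i)$ and all $n_1<n_2<\cdots$. A basis is bimonotone if all projections $\sum_i a_i e_i\mapsto \sum_{i\in I}a_i e_i$, for intervals $I\subseteq\mathbb{N}$, have norm at most $1$. When a spreading basis is not weakly null, the summing functional $S$ is bounded. A sequence $(x_i)$ is suppression $1$-unconditional if $\|\sum_{i\in F}a_i x_i\|\le\|\sum_{i}a_i x_i\|$ for all finitely supported scalars $(a_i)$ and all $F\subseteq\mathbb{N}$. A basis $(d_i)$ is skipped unconditional if every normalized block basis $(x_j)$ of $(d_i)$ for which there is a strictly increasing sequence $(i_j)$ in $\mathbb{N}$ with $\mathrm{supp}(x_j)<i_j<\mathrm{supp}(x_{j+1})$ for all $j$ is an unconditional basic sequence, where $\mathrm{supp}(x)=\{i: b_i\ne 0\}$ for $x=\sum_i b_i d_i$. $X$ is quasi-reflexive of order $1$ if the canonical image of $X$ in $X^{**}$ has codimension exactly $1$. *)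

theory Defs
  imports "HOL-Analysis.Analysis"
begin

subsection \<open>Schauder bases\<close>

definition closed_span :: "'a::real_normed_vector set \<Rightarrow> 'a set" where
  "closed_span A = closure (span A)"

definition schauder_basis_of :: "(nat \<Rightarrow> 'a::real_normed_vector) \<Rightarrow> 'a set \<Rightarrow> bool" where
  "schauder_basis_of e Y \<longleftrightarrow>
     range e \<subseteq> Y \<and> (\<forall>x\<in>Y. \<exists>!a. (\<lambda>i. a i *\<^sub>R e i) sums x)"

abbreviation schauder_basis :: "(nat \<Rightarrow> 'a::real_normed_vector) \<Rightarrow> bool" where
  "schauder_basis e \<equiv> schauder_basis_of e UNIV"

definition basic_sequence :: "(nat \<Rightarrow> 'a::real_normed_vector) \<Rightarrow> bool" where
  "basic_sequence e \<longleftrightarrow> schauder_basis_of e (closed_span (range e))"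

text \<open>The functions below that mention \<open>coord e\<close> are meaningful when \<open>e\<close> is a Schauder basis
  of the whole space.\<close>

definition coord :: "(nat \<Rightarrow> 'a::real_normed_vector) \<Rightarrow> 'a \<Rightarrow> nat \<Rightarrow> real" where
  "coord e x = (THE a. (\<lambda>i. a i *\<^sub>R e i) sums x)"

definition supp :: "(nat \<Rightarrow> 'a::real_normed_vector) \<Rightarrow> 'a \<Rightarrow> nat set" where
  "supp e x = {i. coord e x i \<noteq> 0}"

definition biorthogonal :: "(nat \<Rightarrow> 'a::real_normed_vector) \<Rightarrow> nat \<Rightarrow> 'a \<Rightarrow>\<^sub>L real" where
  "biorthogonal e i = (THE f. \<forall>j. blinfun_apply f (e j) = (if i = j then 1 else 0))"

definition basis_projection ::
    "(nat \<Rightarrow> 'a::real_normed_vector) \<Rightarrow> nat set \<Rightarrow> 'a \<Rightarrow> 'a" where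
  "basis_projection e I x = (\<Sum>i. (if i \<in> I then coord e x i else 0) *\<^sub>R e i)"

text \<open>The intervals of \<open>\<nat>\<close>, finite or infinite, are the order-convex subsets.\<close>

definition bimonotone :: "(nat \<Rightarrow> 'a::real_normed_vector) \<Rightarrow> bool" where
  "bimonotone e \<longleftrightarrow>
     (\<forall>I. (\<forall>i\<in>I. \<forall>k\<in>I. {i..k} \<subseteq> I) \<longrightarrow> (\<forall>x. norm (basis_projection e I x) \<le> norm x))"

definition boundedly_complete :: "(nat \<Rightarrow> 'a::real_normed_vector) \<Rightarrow> bool" where
  "boundedly_complete e \<longleftrightarrow>
     (\<forall>a. bounded (range (\<lambda>n. \<Sum>i<n. a i *\<^sub>R e i)) \<longrightarrow> summable (\<lambda>i. a i *\<^sub>R e i))"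

definition shrinking :: "(nat \<Rightarrow> 'a::real_normed_vector) \<Rightarrow> bool" where
  "shrinking e \<longleftrightarrow> closed_span (range (biorthogonal e)) = UNIV"

definition weakly_null :: "(nat \<Rightarrow> 'a::real_normed_vector) \<Rightarrow> bool" where
  "weakly_null x \<longleftrightarrow> (\<forall>f :: 'a \<Rightarrow>\<^sub>L real. (\<lambda>i. blinfun_apply f (x i)) \<longlonglongrightarrow> 0)"

definition normalized :: "(nat \<Rightarrow> 'a::real_normed_vector) \<Rightarrow> bool" where
  "normalized x \<longleftrightarrow> (\<forall>i. norm (x i) = 1)"


subsection \<open>Spreading, block and unconditional sequences\<close>

definition one_spreading :: "(nat \<Rightarrow> 'a::real_normed_vector) \<Rightarrow> bool" where
  "one_spreading e \<longleftrightarrow>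
     (\<forall>a n. finite {i. a i \<noteq> 0} \<longrightarrow> strict_mono n \<longrightarrow>
        norm (\<Sum>i | a i \<noteq> 0. a i *\<^sub>R e i) = norm (\<Sum>i | a i \<noteq> 0. a i *\<^sub>R e (n i)))"

definition suppression_1_unconditional :: "(nat \<Rightarrow> 'a::real_normed_vector) \<Rightarrow> bool" where
  "suppression_1_unconditional x \<longleftrightarrow>
     (\<forall>a F. finite {i. a i \<noteq> 0} \<longrightarrow>
        norm (\<Sum>i | i \<in> F \<and> a i \<noteq> 0. a i *\<^sub>R x i) \<le> norm (\<Sum>i | a i \<noteq> 0. a i *\<^sub>R x i))"

definition block_basis ::
    "(nat \<Rightarrow> 'a::real_normed_vector) \<Rightarrow> (nat \<Rightarrow> 'a) \<Rightarrow> bool" where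
  "block_basis e x \<longleftrightarrow>
     (\<forall>j. x j \<noteq> 0) \<and>
     (\<exists>p a. strict_mono p \<and> (\<forall>j. x j = (\<Sum>i\<in>{p j..<p (Suc j)}. a i *\<^sub>R e i)))"

text \<open>\<open>has_sum\<close> is convergence along the net of finite sets of indices, that is,
  unconditional convergence of the basis expansion.\<close>

definition unconditional_basic_sequence :: "(nat \<Rightarrow> 'a::real_normed_vector) \<Rightarrow> bool" where
  "unconditional_basic_sequence x \<longleftrightarrow>
     basic_sequence x \<and>
     (\<forall>a y. (\<lambda>i. a i *\<^sub>R x i) sums y \<longrightarrow> ((\<lambda>i. a i *\<^sub>R x i) has_sum y) UNIV)"

definition skipped_unconditional_basis :: "(nat \<Rightarrow> 'a::real_normed_vector) \<Rightarrow> bool" where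
  "skipped_unconditional_basis d \<longleftrightarrow>
     schauder_basis d \<and>
     (\<forall>x. normalized x \<and> block_basis d x \<and>
        (\<exists>i. strict_mono i \<and>
           (\<forall>j. (\<forall>k\<in>supp d (x j). k < i j) \<and> (\<forall>k\<in>supp d (x (Suc j)). i j < k)))
        \<longrightarrow> unconditional_basic_sequence x)"

definition difference_sequence :: "(nat \<Rightarrow> 'a::real_normed_vector) \<Rightarrow> nat \<Rightarrow> 'a" where
  "difference_sequence e i = (case i of 0 \<Rightarrow> e 0 | Suc k \<Rightarrow> e (Suc k) - e k)"

definition summing_functional :: "(nat \<Rightarrow> 'a::real_normed_vector) \<Rightarrow> 'a \<Rightarrow> real" where
  "summing_functional e x = (\<Sum>i. coord e x i)"


subsection \<open>Embeddings of \<open>c\<^sub>0\<close> and \<open>\<ell>\<^sub>1\<close>\<close>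

text \<open>A linear isomorphism of a space \<open>V\<close> of scalar sequences, normed by \<open>N\<close>, onto a
  subspace of the target.\<close>

definition isomorphic_embedding ::
    "(nat \<Rightarrow> real) set \<Rightarrow> ((nat \<Rightarrow> real) \<Rightarrow> real) \<Rightarrow>
     ((nat \<Rightarrow> real) \<Rightarrow> 'a::real_normed_vector) \<Rightarrow> bool" where
  "isomorphic_embedding V N T \<longleftrightarrow>
     (\<forall>a\<in>V. \<forall>b\<in>V. T (\<lambda>i. a i + b i) = T a + T b) \<and>
     (\<forall>c. \<forall>a\<in>V. T (\<lambda>i. c * a i) = c *\<^sub>R T a) \<and>
     (\<exists>m>0. \<exists>M. \<forall>a\<in>V. m * N a \<le> norm (T a) \<and> norm (T a) \<le> M * N a)"

definition c0_embeds :: "'a::real_normed_vector itself \<Rightarrow> bool" where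
  "c0_embeds X \<longleftrightarrow>
     (\<exists>T :: (nat \<Rightarrow> real) \<Rightarrow> 'a.
        isomorphic_embedding {a. a \<longlonglongrightarrow> 0} (\<lambda>a. SUP i. \<bar>a i\<bar>) T)"

definition l1_embeds :: "'a::real_normed_vector itself \<Rightarrow> bool" where
  "l1_embeds X \<longleftrightarrow>
     (\<exists>T :: (nat \<Rightarrow> real) \<Rightarrow> 'a.
        isomorphic_embedding {a. summable (\<lambda>i. \<bar>a i\<bar>)} (\<lambda>a. \<Sum>i. \<bar>a i\<bar>) T)"


subsection \<open>Direct sums and quasi-reflexivity\<close>

text \<open>The whole space is the internal direct sum of the linear subspaces \<open>U\<close> and \<open>V\<close>.\<close>

definition direct_sum_decomposition :: "'a::real_vector set \<Rightarrow> 'a set \<Rightarrow> bool" where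
  "direct_sum_decomposition U V \<longleftrightarrow>
     U \<inter> V = {0} \<and> {u + v | u v. u \<in> U \<and> v \<in> V} = UNIV"

definition has_codimension :: "'a::real_vector set \<Rightarrow> nat \<Rightarrow> bool" where
  "has_codimension U n \<longleftrightarrow>
     (\<exists>B. finite B \<and> card B = n \<and> independent B \<and> direct_sum_decomposition (span B) U)"

definition canonical_embedding ::
    "'a::real_normed_vector \<Rightarrow> ('a \<Rightarrow>\<^sub>L real) \<Rightarrow>\<^sub>L real" where
  "canonical_embedding x = Blinfun (\<lambda>f. blinfun_apply f x)"

definition quasi_reflexive_of_order :: "nat \<Rightarrow> 'a::real_normed_vector itself \<Rightarrow> bool" where
  "quasi_reflexive_of_order n X \<longleftrightarrow>
     has_codimension (range (canonical_embedding :: 'a \<Rightarrow> ('a \<Rightarrow>\<^sub>L real) \<Rightarrow>\<^sub>L real)) n"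

end

theory Submission
  imports Defs "HOL-Library.Diagonal_Subsequence"
begin

text \<open>A block with coefficient sum zero is nearly annihilated by averaging over many of its
  translates, while spreading keeps the norm of each translated vector fixed. Hence such a block can be
  removed from a vector without increasing the norm, and zero-sum blocks are suppression
  \<open>1\<close>-unconditional. Blocks of the difference sequence have coefficient sum zero, except perhaps the
  first, which is removed by bimonotonicity. A bounded divergent series in \<open>(e\<^sub>i)\<close>, doubled
  with opposite signs, produces zero-sum blocks equivalent to the basis of \<open>c\<^sub>0\<close>. A functional
  outside \<open>[S, (e\<^sub>i\<^sup>*)]\<close> produces zero-sum blocks equivalent to the basis of
  \<open>\<ell>\<^sub>1\<close>. Conversely, gliding humps exclude \<open>c\<^sub>0\<close> when \<open>(e\<^sub>i)\<close> is boundedly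
  complete, and diagonal subsequences exclude \<open>\<ell>\<^sub>1\<close> when \<open>X\<^sup>* = [S, (e\<^sub>i\<^sup>*)]\<close>. For
  quasi-reflexivity, the extra dimension of the bidual is spanned by a functional that vanishes on the
  \<open>e\<^sub>i\<^sup>*\<close> but not on \<open>S\<close>.\<close>

subsection \<open>The Hahn-Banach theorem and closed spans\<close>

text \<open>The obstacle is that (e_i) need not be unconditional: S may record a cancellation that
  an arbitrary suppression destroys. Sum zero is therefore built into the blocks that carry c_0 or
  l_1, either by doubling with opposite signs or by subtracting a multiple of one basis vector,
  whose size the bound on S controls. That bound comes from the failure of weak nullness: some
  functional tends to a nonzero constant along a subsequence of the basis, and spreading pushes any
  finite combination out to where this functional is nearly that constant times the coefficient sum.
  S has to be adjoined to the coordinate functionals because every functional in their closed span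
  tends to 0 along (e_n), where S stays 1. The functionals biorthogonal to (d_i) are the tails of S
  and span the same space as S and the coordinate functionals, so d) and e) are one statement about
  the dual. In the converse of f), codimension one is used as linear dependence modulo X: the extra
  functional always exists, and a failure of bounded completeness or of the dual decomposition would
  supply a second, independent one.\<close>

text \<open>A partial functional is encoded as its graph, so that extension is inclusion and Zorn's
  lemma applies to unions of chains. The one-sided bound already forces the graph to be
  single-valued: the difference of two values over the same point is a value over 0, hence at most
  0, in both orders.\<close>

lemma hahn_banach_graph:
  fixes F :: "('a::real_normed_vector \<times> real) set"
  assumes F: "subspace F" and bd: "\<And>x t. (x, t) \<in> F \<Longrightarrow> t \<le> K * norm x" and K: "0 \<le> K"
  obtains g :: "'a \<Rightarrow>\<^sub>L real"
  where "norm g \<le> K" "\<And>x t. (x, t) \<in> F \<Longrightarrow> blinfun_apply g x = t"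
proof -
  define \<A> where "\<A> = {G :: ('a \<times> real) set. subspace G \<and> F \<subseteq> G \<and> (\<forall>x t. (x, t) \<in> G \<longrightarrow> t \<le> K * norm x)}"
  have "\<exists>M\<in>\<A>. \<forall>X\<in>\<A>. M \<subseteq> X \<longrightarrow> X = M"
  proof (rule subset_Zorn_nonempty)
    show "\<A> \<noteq> {}" using F bd unfolding \<A>_def by blast
  next
    fix C assume C0: "C \<noteq> {}" and ch: "subset.chain \<A> C"
    have sub: "C \<subseteq> \<A>" and lin: "\<And>X Y. X \<in> C \<Longrightarrow> Y \<in> C \<Longrightarrow> X \<subseteq> Y \<or> Y \<subseteq> X"
      using ch by (auto simp: subset_chain_def)
    have ss: "\<And>X. X \<in> C \<Longrightarrow> subspace X" using sub by (auto simp: \<A>_def)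
    have "subspace (\<Union>C)"
    proof (rule subspaceI)
      show "0 \<in> \<Union>C" using C0 ss subspace_0 by blast
    next
      fix x y assume "x \<in> \<Union>C" "y \<in> \<Union>C"
      then obtain X Y where "X \<in> C" "Y \<in> C" "x \<in> X" "y \<in> Y" by blast
      then show "x + y \<in> \<Union>C" using lin[of X Y] ss subspace_add by blast
    next
      fix c x assume "x \<in> \<Union>C"
      then show "c *\<^sub>R x \<in> \<Union>C" using ss subspace_scale by blast
    qed
    moreover have "F \<subseteq> \<Union>C" using C0 sub by (auto simp: \<A>_def)
    ultimately show "\<Union>C \<in> \<A>" using sub by (auto simp: \<A>_def)
  qed
  then obtain G where GA: "G \<in> \<A>" and max: "\<And>X. X \<in> \<A> \<Longrightarrow> G \<subseteq> X \<Longrightarrow> X = G" by blast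
  have G: "subspace G" "F \<subseteq> G" and Gb: "\<And>x t. (x, t) \<in> G \<Longrightarrow> t \<le> K * norm x"
    using GA by (auto simp: \<A>_def)
  have addG: "\<And>x s y t. (x, s) \<in> G \<Longrightarrow> (y, t) \<in> G \<Longrightarrow> (x + y, s + t) \<in> G"
    using subspace_add[OF G(1)] by fastforce
  have scaleG: "\<And>c x s. (x, s) \<in> G \<Longrightarrow> (c *\<^sub>R x, c * s) \<in> G"
    using subspace_scale[OF G(1)] by fastforce
  have zeroG: "(0, 0) \<in> G" using subspace_0[OF G(1)] by (simp add: zero_prod_def)
  have le: "s \<le> t" if "(x, s) \<in> G" "(x, t) \<in> G" for x s t
    using Gb[OF addG[OF that(1) scaleG[OF that(2), of "-1"]]] by simp
  have uniq: "s = t" if "(x, s) \<in> G" "(x, t) \<in> G" for x s t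
    using le[OF that] le[OF that(2,1)] by simp
  have total: "\<exists>t. (x0, t) \<in> G" for x0
  proof -
    \<comment> \<open>An admissible value at \<open>x0\<close> must lie above every member of
      \<open>?L\<close> and below every \<open>K * norm (y' + x0) - s'\<close>. By \<open>ub\<close>
      these two families are separated, so the supremum of the lower one will do.\<close>
    let ?L = "{s - K * norm (y - x0) | y s. (y, s) \<in> G}"
    have ub: "s - K * norm (y - x0) \<le> K * norm (y' + x0) - s'" if "(y, s) \<in> G" "(y', s') \<in> G" for y s y' s'
    proof -
      have "s + s' \<le> K * norm (y + y')" using Gb[OF addG[OF that]] by simp
      also have "\<dots> \<le> K * (norm (y - x0) + norm (y' + x0))"
        using norm_triangle_ineq[of "y - x0" "y' + x0"] by (intro mult_left_mono K) simp
      finally show ?thesis by (simp add: algebra_simps)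
    qed
    define \<alpha> where "\<alpha> = Sup ?L"
    have bdd: "bdd_above ?L" unfolding bdd_above_def using ub[OF _ zeroG] by blast
    have lo: "s - K * norm (y - x0) \<le> \<alpha>" if "(y, s) \<in> G" for y s
      unfolding \<alpha>_def by (rule cSup_upper[OF _ bdd]) (use that in blast)
    have hi: "\<alpha> \<le> K * norm (y + x0) - s" if "(y, s) \<in> G" for y s
      unfolding \<alpha>_def by (rule cSup_least) (use zeroG ub that in blast)+
    let ?H = "span (insert (x0, \<alpha>) G)"
    have Hb: "t \<le> K * norm x" if xt: "(x, t) \<in> ?H" for x t
    proof -
      obtain c where "(x, t) - c *\<^sub>R (x0, \<alpha>) \<in> span G" using xt unfolding span_insert by blast
      then have c: "(x - c *\<^sub>R x0, t - c * \<alpha>) \<in> G" using G(1) by (metis diff_Pair real_scaleR_def scaleR_Pair span_eq_iff)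
      \<comment> \<open>Dividing by the absolute value of \<open>c\<close> reduces to coefficient 1
        or -1 at \<open>x0\<close>, which are the inequalities \<open>hi\<close> and
        \<open>lo\<close>.\<close>
      consider "c = 0" | "c > 0" | "c < 0" by linarith
      then show ?thesis
      proof cases
        case 1 then show ?thesis using Gb[OF c] by simp
      next
        case 2
        have "\<alpha> \<le> K * norm (inverse c *\<^sub>R (x - c *\<^sub>R x0) + x0) - inverse c * (t - c * \<alpha>)"
          by (rule hi[OF scaleG[OF c]])
        also have "inverse c *\<^sub>R (x - c *\<^sub>R x0) + x0 = inverse c *\<^sub>R x" using 2 by (simp add: algebra_simps)
        finally have "\<alpha> \<le> K * (inverse c * norm x) - inverse c * (t - c * \<alpha>)" using 2 by simp
        then have "c * \<alpha> \<le> c * (K * (inverse c * norm x) - inverse c * (t - c * \<alpha>))" using 2 by simp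
        then show ?thesis using 2 by (simp add: field_simps)
      next
        case 3
        define k where "k = - c"
        have k: "k > 0" "c = - k" using 3 by (auto simp: k_def)
        have "inverse k * (t - c * \<alpha>) - K * norm (inverse k *\<^sub>R (x - c *\<^sub>R x0) - x0) \<le> \<alpha>"
          by (rule lo[OF scaleG[OF c]])
        also have "inverse k *\<^sub>R (x - c *\<^sub>R x0) - x0 = inverse k *\<^sub>R x" using k by (simp add: algebra_simps)
        finally have "inverse k * (t - c * \<alpha>) - K * (inverse k * norm x) \<le> \<alpha>" using k by simp
        then have "k * (inverse k * (t - c * \<alpha>) - K * (inverse k * norm x)) \<le> k * \<alpha>" using k by simp
        then show ?thesis using k by (simp add: field_simps)
      qed
    qed
    have "G \<subseteq> ?H" by (meson span_superset subset_insertI subset_trans)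
    then have "?H \<in> \<A>" using G Hb by (auto simp: \<A>_def)
    then have "?H = G" using max \<open>G \<subseteq> ?H\<close> by blast
    then show ?thesis by (metis insertI1 span_base)
  qed
  define g where "g x = (THE t. (x, t) \<in> G)" for x
  have g: "(x, t) \<in> G \<longleftrightarrow> g x = t" for x t
    unfolding g_def using total uniq by (metis the_equality)
  have gb: "\<bar>g x\<bar> \<le> norm x * K" for x
    using Gb[of x "g x"] Gb[OF scaleG[of x "g x" "-1"]] g by (auto simp: mult.commute)
  have "bounded_linear g"
  proof (rule bounded_linear_intro[where K = K])
    show "g (x + y) = g x + g y" for x y using addG g by blast
    show "g (c *\<^sub>R x) = c *\<^sub>R g x" for c x using scaleG g by (metis real_scaleR_def)
    show "norm (g x) \<le> norm x * K" for x using gb by simp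
  qed
  then have "blinfun_apply (Blinfun g) = g" by (rule bounded_linear_Blinfun_apply)
  moreover have "norm (Blinfun g) \<le> K"
    using calculation gb K by (intro norm_blinfun_bound) (auto simp: mult.commute)
  moreover have "g x = t" if "(x, t) \<in> F" for x t using that G(2) g by blast
  ultimately show ?thesis using that[of "Blinfun g"] by metis
qed

lemma norming_functional:
  fixes x :: "'a::real_normed_vector"
  obtains f :: "'a \<Rightarrow>\<^sub>L real" where "norm f \<le> 1" "blinfun_apply f x = norm x"
proof -
  have "t \<le> 1 * norm y" if "(y, t) \<in> span {(x, norm x)}" for y t
    using that by (auto simp: span_singleton intro!: mult_right_mono)
  then obtain f :: "'a \<Rightarrow>\<^sub>L real" where "norm f \<le> 1" "\<And>y t. (y, t) \<in> span {(x, norm x)} \<Longrightarrow> blinfun_apply f y = t"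
    using hahn_banach_graph[of "span {(x, norm x)}" 1] by auto
  then show ?thesis using that by (auto intro: span_base)
qed

text \<open>On the span of \<open>V\<close> and \<open>x\<close>, the functional sending
  \<open>v + t x\<close> to \<open>t\<close> has norm at most \<open>1 / r\<close>, where
  \<open>r\<close> is the distance from \<open>x\<close> to \<open>V\<close>. This distance is
  positive because \<open>V\<close> is closed.\<close>

lemma separating_functional:
  fixes V :: "'a::real_normed_vector set"
  assumes V: "subspace V" "closed V" "x \<notin> V"
  shows "\<exists>f :: 'a \<Rightarrow>\<^sub>L real. (\<forall>v\<in>V. blinfun_apply f v = 0) \<and> blinfun_apply f x = 1"
proof -
  define r where "r = infdist x V"
  have ne: "V \<noteq> {}" using V(1) subspace_0 by blast
  have r: "r > 0" using V(2,3) ne by (simp add: r_def in_closed_iff_infdist_zero infdist_nonneg less_le)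
  let ?F = "span (insert (x, 1) (V \<times> {0::real}))"
  have VF: "subspace (V \<times> {0::real})" using V(1) by (auto simp: subspace_def zero_prod_def)
  have "t \<le> inverse r * norm y" if yt: "(y, t) \<in> ?F" for y t
  proof -
    have "t * r \<le> norm y"
    proof (cases "t > 0")
      case True
      obtain c where "(y, t) - c *\<^sub>R (x, 1) \<in> span (V \<times> {0::real})" using yt unfolding span_insert by blast
      then have "(y, t) - c *\<^sub>R (x, 1) \<in> V \<times> {0}" using VF by (metis span_eq_iff)
      then have v: "y - t *\<^sub>R x \<in> V" by auto
      then have "- inverse t *\<^sub>R (y - t *\<^sub>R x) \<in> V" using V(1) subspace_scale by blast
      from infdist_le[OF this, of x] have "r \<le> norm (inverse t *\<^sub>R y)"
        using True by (simp add: r_def dist_norm algebra_simps)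
      then show ?thesis using True by (simp add: field_simps)
    next
      case False
      then show ?thesis using r by (meson less_le_not_le linorder_linear mult_nonpos_nonneg norm_ge_zero order_trans)
    qed
    then show ?thesis using r by (simp add: field_simps)
  qed
  then obtain f :: "'a \<Rightarrow>\<^sub>L real" where "\<And>y t. (y, t) \<in> ?F \<Longrightarrow> blinfun_apply f y = t"
    using hahn_banach_graph[of ?F "inverse r"] r by (metis inverse_nonnegative_iff_nonnegative less_imp_le subspace_span)
  then have "blinfun_apply f y = t" if "(y, t) \<in> insert (x, 1) (V \<times> {0})" for y t
    using that by (simp add: span_base)
  then show ?thesis by (intro exI[of _ f] conjI ballI) auto
qed

lemma subspace_closed_span: "subspace (closed_span A)"
proof -
  have cl: "x \<in> closure (span A) \<longleftrightarrow> (\<exists>u. (\<forall>n. u n \<in> span A) \<and> u \<longlonglongrightarrow> x)" for x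
    by (rule closure_sequential)
  show ?thesis
    unfolding closed_span_def
  proof (rule subspaceI)
    show "0 \<in> closure (span A)" by (rule subsetD[OF closure_subset]) (rule span_zero)
  next
    fix x y assume "x \<in> closure (span A)" "y \<in> closure (span A)"
    then obtain u v where "\<And>n. u n \<in> span A" "u \<longlonglongrightarrow> x" "\<And>n. v n \<in> span A" "v \<longlonglongrightarrow> y"
      unfolding cl by blast
    then show "x + y \<in> closure (span A)"
      unfolding cl by (intro exI[of _ "\<lambda>n. u n + v n"]) (simp add: span_add tendsto_add)
  next
    fix c x assume "x \<in> closure (span A)"
    then obtain u where "\<And>n. u n \<in> span A" "u \<longlonglongrightarrow> x" unfolding cl by blast
    then show "c *\<^sub>R x \<in> closure (span A)"
      unfolding cl by (intro exI[of _ "\<lambda>n. c *\<^sub>R u n"]) (simp add: span_scale tendsto_scaleR)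
  qed
qed

lemma closed_closed_span: "closed (closed_span A)"
  by (simp add: closed_span_def)

lemma span_subset_closed_span: "span A \<subseteq> closed_span A"
  by (simp add: closed_span_def closure_subset)

lemma closed_span_minimal:
  assumes "A \<subseteq> V" "subspace V" "closed V"
  shows "closed_span A \<subseteq> V"
  unfolding closed_span_def using assms by (metis closure_minimal span_minimal)

text \<open>Since the \<open>y n\<close> are bounded, approximating \<open>f\<close> in norm by an
  element of the span approximates all the values at \<open>y n\<close> uniformly in
  \<open>n\<close>.\<close>

lemma blinfun_tendsto_zero_closed_span:
  fixes H :: "('a::real_normed_vector \<Rightarrow>\<^sub>L real) set"
  assumes y: "\<And>n. norm (y n) \<le> B" and H: "\<And>h. h \<in> H \<Longrightarrow> (\<lambda>n. blinfun_apply h (y n)) \<longlonglongrightarrow> 0"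
    and f: "f \<in> closed_span H"
  shows "(\<lambda>n. blinfun_apply f (y n)) \<longlonglongrightarrow> 0"
proof -
  have B: "0 \<le> B" using y[of 0] norm_ge_zero order_trans by blast
  have sp: "(\<lambda>n. blinfun_apply g (y n)) \<longlonglongrightarrow> 0" if "g \<in> span H" for g
    using that
  proof (induction rule: span_induct_alt)
    case base then show ?case by simp
  next
    case (step c x z)
    then show ?case using tendsto_add[OF tendsto_mult_right_zero[OF H[OF step(1)], of c] step(2)]
      by (simp add: blinfun.add_left blinfun.scaleR_left)
  qed
  show ?thesis
  proof (rule LIMSEQ_I)
    fix \<epsilon> :: real assume \<epsilon>: "\<epsilon> > 0"
    define \<eta> where "\<eta> = \<epsilon> / (2 * (B + 1))"
    have \<eta>: "\<eta> > 0" "\<eta> * B \<le> \<epsilon> / 2" using \<epsilon> B by (auto simp: \<eta>_def field_simps)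
    obtain g where g: "g \<in> span H" "dist g f < \<eta>"
      using f \<eta>(1) unfolding closed_span_def closure_approachable by blast
    obtain N where N: "\<And>n. n \<ge> N \<Longrightarrow> \<bar>blinfun_apply g (y n)\<bar> < \<epsilon> / 2"
      using LIMSEQ_D[OF sp[OF g(1)], of "\<epsilon> / 2"] \<epsilon> by auto
    have "norm (blinfun_apply f (y n) - 0) < \<epsilon>" if "n \<ge> N" for n
    proof -
      have "\<bar>blinfun_apply (f - g) (y n)\<bar> \<le> norm (f - g) * norm (y n)"
        using norm_blinfun[of "f - g" "y n"] by simp
      also have "\<dots> \<le> \<eta> * B" using g(2) y by (intro mult_mono) (auto simp: dist_norm norm_minus_commute \<eta> less_imp_le)
      finally show ?thesis using N[OF that] \<eta>(2) by (simp add: blinfun.diff_left)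
    qed
    then show "\<exists>N. \<forall>n\<ge>N. norm (blinfun_apply f (y n) - 0) < \<epsilon>" by blast
  qed
qed

subsection \<open>Suppression unconditional sequences\<close>

text \<open>Replaces supports by explicit index sets on which coefficients may vanish, so that sums
  can be split and enlarged freely.\<close>

lemma suppression_1_unconditional_iff:
  "suppression_1_unconditional x \<longleftrightarrow>
     (\<forall>a A F. finite A \<longrightarrow> F \<subseteq> A \<longrightarrow> norm (\<Sum>i\<in>F. a i *\<^sub>R x i) \<le> norm (\<Sum>i\<in>A. a i *\<^sub>R x i))"
  (is "?L \<longleftrightarrow> ?R")
proof
  assume ?L
  show ?R
  proof (intro allI impI)
    fix a :: "nat \<Rightarrow> real" and A F :: "nat set" assume A: "finite A" and F: "F \<subseteq> A"
    define b where "b i = (if i \<in> A then a i else 0)" for i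
    have "finite {i. b i \<noteq> 0}" by (rule finite_subset[OF _ A]) (auto simp: b_def)
    then have "norm (\<Sum>i | i \<in> F \<and> b i \<noteq> 0. b i *\<^sub>R x i) \<le> norm (\<Sum>i | b i \<noteq> 0. b i *\<^sub>R x i)"
      using \<open>?L\<close> by (simp add: suppression_1_unconditional_def)
    moreover have "(\<Sum>i | i \<in> F \<and> b i \<noteq> 0. b i *\<^sub>R x i) = (\<Sum>i\<in>F. a i *\<^sub>R x i)"
      using F A by (intro sum.mono_neutral_cong_left) (auto simp: b_def finite_subset)
    moreover have "(\<Sum>i | b i \<noteq> 0. b i *\<^sub>R x i) = (\<Sum>i\<in>A. a i *\<^sub>R x i)"
      using A by (intro sum.mono_neutral_cong_left) (auto simp: b_def)
    ultimately show "norm (\<Sum>i\<in>F. a i *\<^sub>R x i) \<le> norm (\<Sum>i\<in>A. a i *\<^sub>R x i)" by simp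
  qed
next
  assume ?R
  show ?L
    unfolding suppression_1_unconditional_def
  proof (intro allI impI)
    fix a :: "nat \<Rightarrow> real" and F :: "nat set" assume fin: "finite {i. a i \<noteq> 0}"
    have "{i. i \<in> F \<and> a i \<noteq> 0} \<subseteq> {i. a i \<noteq> 0}" by blast
    then show "norm (\<Sum>i | i \<in> F \<and> a i \<noteq> 0. a i *\<^sub>R x i) \<le> norm (\<Sum>i | a i \<noteq> 0. a i *\<^sub>R x i)"
      using \<open>?R\<close> fin by blast
  qed
qed

lemma suppression_1_unconditionalD:
  assumes "suppression_1_unconditional x" "finite A" "F \<subseteq> A"
  shows "norm (\<Sum>i\<in>F. a i *\<^sub>R x i) \<le> norm (\<Sum>i\<in>A. a i *\<^sub>R x i)"
  using assms by (simp add: suppression_1_unconditional_iff)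

lemma suppression_1_unconditional_sum_le_sums:
  assumes "suppression_1_unconditional x" "finite F" and y: "(\<lambda>i. a i *\<^sub>R x i) sums y"
  shows "norm (\<Sum>i\<in>F. a i *\<^sub>R x i) \<le> norm y"
proof (rule tendsto_lowerbound[OF tendsto_norm[OF y[unfolded sums_def]]])
  obtain N where "F \<subseteq> {..<N}" using \<open>finite F\<close> finite_nat_iff_bounded by blast
  then have "norm (\<Sum>i\<in>F. a i *\<^sub>R x i) \<le> norm (\<Sum>i<n. a i *\<^sub>R x i)" if "n \<ge> N" for n
    using that by (intro suppression_1_unconditionalD assms(1)) auto
  then show "\<forall>\<^sub>F n in sequentially. norm (\<Sum>i\<in>F. a i *\<^sub>R x i) \<le> norm (\<Sum>i<n. a i *\<^sub>R x i)"
    by (auto simp: eventually_sequentially)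
qed simp

lemma suppression_1_unconditional_coeff_le:
  assumes "suppression_1_unconditional x" "(\<lambda>i. a i *\<^sub>R x i) sums y"
  shows "\<bar>a j\<bar> * norm (x j) \<le> norm y"
  using suppression_1_unconditional_sum_le_sums[OF assms(1) _ assms(2), of "{j}"] by simp

text \<open>Every coefficient is controlled by the norm of the sum. This gives uniqueness of
  expansions and makes the set \<open>W\<close> of sums of convergent series complete, so that
  \<open>W\<close> contains the closed span.\<close>

lemma suppression_1_unconditional_imp_basic_sequence:
  fixes x :: "nat \<Rightarrow> 'a::banach"
  assumes s: "suppression_1_unconditional x" and nz: "\<And>i. x i \<noteq> 0"
  shows "basic_sequence x"
proof -
  define W where "W = {y. \<exists>a. (\<lambda>i. a i *\<^sub>R x i) sums y}"
  have "subspace W"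
  proof (rule subspaceI)
    show "0 \<in> W" unfolding W_def by (auto intro!: exI[of _ "\<lambda>_. 0"])
  next
    fix y z assume "y \<in> W" "z \<in> W"
    then obtain a b where "(\<lambda>i. a i *\<^sub>R x i) sums y" "(\<lambda>i. b i *\<^sub>R x i) sums z" by (auto simp: W_def)
    from sums_add[OF this] have "(\<lambda>i. (a i + b i) *\<^sub>R x i) sums (y + z)" by (simp add: scaleR_add_left)
    then show "y + z \<in> W" unfolding W_def by (intro CollectI exI)
  next
    fix c y assume "y \<in> W"
    then obtain a where "(\<lambda>i. a i *\<^sub>R x i) sums y" by (auto simp: W_def)
    from sums_scaleR_right[OF this, of c] have "(\<lambda>i. (c * a i) *\<^sub>R x i) sums (c *\<^sub>R y)" by simp
    then show "c *\<^sub>R y \<in> W" unfolding W_def by (intro CollectI exI)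
  qed
  moreover have "range x \<subseteq> W"
  proof
    fix y assume "y \<in> range x"
    then obtain j where j: "y = x j" by blast
    have "(\<lambda>i. (if i = j then 1 else 0) *\<^sub>R x i) sums x j"
      using sums_single[of j x] by (simp add: if_distrib[of "\<lambda>c. c *\<^sub>R _"] cong: if_cong)
    then show "y \<in> W" unfolding W_def j by (intro CollectI exI[of _ "\<lambda>i. if i = j then 1 else 0"])
  qed
  moreover have "closed W"
    unfolding closed_sequential_limits
  proof (intro allI impI)
    fix y l assume yl: "(\<forall>n. y n \<in> W) \<and> y \<longlonglongrightarrow> l"
    then have "\<forall>n. \<exists>a. (\<lambda>i. a i *\<^sub>R x i) sums y n" by (auto simp: W_def)
    then obtain a where a: "\<And>n. (\<lambda>i. a n i *\<^sub>R x i) sums y n" by metis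
    have diff: "(\<lambda>i. (a n i - a m i) *\<^sub>R x i) sums (y n - y m)" for n m
      using sums_diff[OF a[of n] a[of m]] by (simp add: scaleR_diff_left)
    have Cy: "Cauchy y" using yl LIMSEQ_imp_Cauchy by blast
    have "Cauchy (\<lambda>n. a n j)" for j
    proof (rule metric_CauchyI)
      fix \<epsilon> :: real assume "\<epsilon> > 0"
      then obtain M where M: "\<And>m n. m \<ge> M \<Longrightarrow> n \<ge> M \<Longrightarrow> dist (y m) (y n) < \<epsilon> * norm (x j)"
        using metric_CauchyD[OF Cy, of "\<epsilon> * norm (x j)"] nz[of j] by auto
      have "dist (a m j) (a n j) < \<epsilon>" if "m \<ge> M" "n \<ge> M" for m n
      proof -
        have "dist (a m j) (a n j) * norm (x j) < \<epsilon> * norm (x j)"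
          using M[OF that] suppression_1_unconditional_coeff_le[OF s diff, of m j n] by (simp add: dist_norm)
        then show ?thesis using nz[of j] by simp
      qed
      then show "\<exists>M. \<forall>m\<ge>M. \<forall>n\<ge>M. dist (a m j) (a n j) < \<epsilon>" by blast
    qed
    then have "\<forall>j. \<exists>b. (\<lambda>n. a n j) \<longlonglongrightarrow> b" using Cauchy_convergent convergent_def by blast
    then obtain b where b: "\<And>j. (\<lambda>n. a n j) \<longlonglongrightarrow> b j" by metis
    have "(\<lambda>i. b i *\<^sub>R x i) sums l"
      unfolding sums_def
    proof (rule metric_LIMSEQ_I)
      fix \<epsilon> :: real assume \<epsilon>: "\<epsilon> > 0"
      obtain n where n: "\<And>m. m \<ge> n \<Longrightarrow> dist (y n) (y m) < \<epsilon> / 4"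
        using metric_CauchyD[OF Cy, of "\<epsilon> / 4"] \<epsilon> by auto
      have yn: "norm (y n - l) \<le> \<epsilon> / 4"
      proof (rule tendsto_upperbound)
        show "(\<lambda>m. norm (y n - y m)) \<longlonglongrightarrow> norm (y n - l)" using yl by (intro tendsto_intros) auto
        show "\<forall>\<^sub>F m in sequentially. norm (y n - y m) \<le> \<epsilon> / 4"
          using n by (auto simp: eventually_sequentially dist_norm less_imp_le intro!: exI[of _ n])
      qed simp
      \<comment> \<open>The bound does not depend on \<open>N\<close>, which is what permits
        exchanging the limit over the vectors \<open>y n\<close> with the limit over partial
        sums.\<close>
      have part: "norm (\<Sum>i<N. (a n i - b i) *\<^sub>R x i) \<le> \<epsilon> / 4" for N
      proof (rule tendsto_upperbound)
        show "(\<lambda>m. norm (\<Sum>i<N. (a n i - a m i) *\<^sub>R x i)) \<longlonglongrightarrow> norm (\<Sum>i<N. (a n i - b i) *\<^sub>R x i)"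
          by (intro tendsto_intros b)
        have "norm (\<Sum>i<N. (a n i - a m i) *\<^sub>R x i) \<le> \<epsilon> / 4" if "m \<ge> n" for m
          using suppression_1_unconditional_sum_le_sums[OF s _ diff, of "{..<N}" n m] n[OF that] by (simp add: dist_norm)
        then show "\<forall>\<^sub>F m in sequentially. norm (\<Sum>i<N. (a n i - a m i) *\<^sub>R x i) \<le> \<epsilon> / 4"
          by (auto simp: eventually_sequentially)
      qed simp
      obtain N0 where N0: "\<And>N. N \<ge> N0 \<Longrightarrow> dist (\<Sum>i<N. a n i *\<^sub>R x i) (y n) < \<epsilon> / 4"
        using metric_LIMSEQ_D[OF a[of n, unfolded sums_def], of "\<epsilon> / 4"] \<epsilon> by auto
      have "dist (\<Sum>i<N. b i *\<^sub>R x i) l < \<epsilon>" if "N \<ge> N0" for N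
      proof -
        have "(\<Sum>i<N. b i *\<^sub>R x i) - l = ((\<Sum>i<N. a n i *\<^sub>R x i) - y n) + (y n - l) - (\<Sum>i<N. (a n i - b i) *\<^sub>R x i)"
          by (simp add: scaleR_diff_left sum_subtractf)
        also have "norm \<dots> \<le> norm ((\<Sum>i<N. a n i *\<^sub>R x i) - y n) + norm (y n - l) + norm (\<Sum>i<N. (a n i - b i) *\<^sub>R x i)"
          by norm
        finally show ?thesis using N0[OF that] yn part[of N] \<epsilon> by (simp add: dist_norm)
      qed
      then show "\<exists>no. \<forall>N\<ge>no. dist (\<Sum>i<N. b i *\<^sub>R x i) l < \<epsilon>" by blast
    qed
    then show "l \<in> W" unfolding W_def by blast
  qed
  ultimately have W: "closed_span (range x) \<subseteq> W" using closed_span_minimal by blast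
  have uniq: "a = b" if "(\<lambda>i. a i *\<^sub>R x i) sums y" "(\<lambda>i. b i *\<^sub>R x i) sums y" for a b y
  proof
    fix j
    have "(\<lambda>i. (a i - b i) *\<^sub>R x i) sums 0"
      using sums_diff[OF that] by (simp add: scaleR_diff_left)
    from suppression_1_unconditional_coeff_le[OF s this, of j] show "a j = b j" using nz[of j] by (simp add: mult_le_0_iff)
  qed
  show ?thesis
    unfolding basic_sequence_def schauder_basis_of_def
    using W uniq span_subset_closed_span[of "range x"] by (fastforce simp: W_def intro: span_base)
qed

text \<open>Once a finite set \<open>F\<close> contains \<open>{..<N}\<close>, the remainder after
  \<open>F\<close> is a suppression of the remainder after \<open>{..<N}\<close>, hence no larger.
  Convergence of the ordered series thus passes to the net of finite sets.\<close>

lemma suppression_1_unconditional_imp_unconditional_basic_sequence: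
  fixes x :: "nat \<Rightarrow> 'a::banach"
  assumes s: "suppression_1_unconditional x" and nz: "\<And>i. x i \<noteq> 0"
  shows "unconditional_basic_sequence x"
proof -
  have "((\<lambda>i. a i *\<^sub>R x i) has_sum y) UNIV" if y: "(\<lambda>i. a i *\<^sub>R x i) sums y" for a y
    unfolding has_sum_def
  proof (rule tendstoI)
    fix \<epsilon> :: real assume "\<epsilon> > 0"
    then obtain N where N: "dist (\<Sum>i<N. a i *\<^sub>R x i) y < \<epsilon>"
      using metric_LIMSEQ_D[OF y[unfolded sums_def]] by blast
    have tail: "(\<lambda>i. (if i < N then 0 else a i) *\<^sub>R x i) sums (y - (\<Sum>i<N. a i *\<^sub>R x i))"
    proof -
      have "(\<lambda>i. if i \<in> {..<N} then a i *\<^sub>R x i else 0) sums (\<Sum>i<N. a i *\<^sub>R x i)"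
        by (rule sums_If_finite_set) simp
      from sums_diff[OF y this] show ?thesis
        by (rule back_subst[of "\<lambda>f. f sums _"]) auto
    qed
    have "dist (sum (\<lambda>i. a i *\<^sub>R x i) F) y < \<epsilon>" if F: "finite F" "{..<N} \<subseteq> F" for F
    proof -
      have tl: "(\<lambda>i. (if i \<in> F then 0 else a i) *\<^sub>R x i) sums (y - (\<Sum>i\<in>F. a i *\<^sub>R x i))"
      proof -
        have "(\<lambda>i. if i \<in> F then a i *\<^sub>R x i else 0) sums (\<Sum>i\<in>F. a i *\<^sub>R x i)"
          by (rule sums_If_finite_set) (rule F(1))
        from sums_diff[OF y this] show ?thesis
          by (rule back_subst[of "\<lambda>f. f sums _"]) auto
      qed
      have "norm (y - (\<Sum>i\<in>F. a i *\<^sub>R x i)) \<le> norm (y - (\<Sum>i<N. a i *\<^sub>R x i))"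
      proof (rule tendsto_upperbound[OF tendsto_norm[OF tl[unfolded sums_def]]])
        have "norm (\<Sum>i<n. (if i \<in> F then 0 else a i) *\<^sub>R x i) \<le> norm (y - (\<Sum>i<N. a i *\<^sub>R x i))" for n
        proof -
          have "(\<Sum>i<n. (if i \<in> F then 0 else a i) *\<^sub>R x i) = (\<Sum>i\<in>{..<n} - F. (if i < N then 0 else a i) *\<^sub>R x i)"
            using F(2) by (intro sum.mono_neutral_cong_right) auto
          then show ?thesis using suppression_1_unconditional_sum_le_sums[OF s _ tail, of "{..<n} - F"] by simp
        qed
        then show "\<forall>\<^sub>F n in sequentially. norm (\<Sum>i<n. (if i \<in> F then 0 else a i) *\<^sub>R x i) \<le> norm (y - (\<Sum>i<N. a i *\<^sub>R x i))"
          by simp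
      qed simp
      then show ?thesis using N by (simp add: dist_norm norm_minus_commute)
    qed
    then show "\<forall>\<^sub>F F in finite_subsets_at_top UNIV. dist (sum (\<lambda>i. a i *\<^sub>R x i) F) y < \<epsilon>"
      unfolding eventually_finite_subsets_at_top by (intro exI[of _ "{..<N}"]) auto
  qed
  then show ?thesis
    using suppression_1_unconditional_imp_basic_sequence[OF assms] by (simp add: unconditional_basic_sequence_def)
qed

section \<open>Criteria for the embedding of c_0 and l_1\<close>

lemma isomorphic_embedding_suminf:
  assumes "\<And>a. a \<in> V \<Longrightarrow> summable (\<lambda>i. a i *\<^sub>R x i)" "m > 0"
    and "\<And>a. a \<in> V \<Longrightarrow> m * N a \<le> norm (\<Sum>i. a i *\<^sub>R x i)"
    and "\<And>a. a \<in> V \<Longrightarrow> norm (\<Sum>i. a i *\<^sub>R x i) \<le> M * N a"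
  shows "isomorphic_embedding V N (\<lambda>a. \<Sum>i. a i *\<^sub>R x i)"
  unfolding isomorphic_embedding_def
proof (intro conjI ballI allI)
  fix a b assume "a \<in> V" "b \<in> V"
  then show "(\<Sum>i. (a i + b i) *\<^sub>R x i) = (\<Sum>i. a i *\<^sub>R x i) + (\<Sum>i. b i *\<^sub>R x i)"
    using assms(1) by (simp add: scaleR_add_left suminf_add)
next
  fix c a assume "a \<in> V"
  then show "(\<Sum>i. (c * a i) *\<^sub>R x i) = c *\<^sub>R (\<Sum>i. a i *\<^sub>R x i)"
    using suminf_scaleR_right[OF assms(1), of a c] by simp
next
  show "\<exists>m>0. \<exists>M. \<forall>a\<in>V. m * N a \<le> norm (\<Sum>i. a i *\<^sub>R x i) \<and> norm (\<Sum>i. a i *\<^sub>R x i) \<le> M * N a"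
    using assms(2-4) by blast
qed

text \<open>Splitting \<open>A\<close> by the sign of \<open>f\<close> leaves two subsums with all
  coefficients 1. Each is a suppression of an initial partial sum, so its norm is at most
  \<open>M\<close>; the two signs account for the factor 2.\<close>

lemma suppression_1_unconditional_abs_functional_le:
  fixes f :: "'a::real_normed_vector \<Rightarrow>\<^sub>L real"
  assumes s: "suppression_1_unconditional x" and bd: "\<And>n. norm (\<Sum>j<n. x j) \<le> M" and A: "finite A"
  shows "(\<Sum>j\<in>A. \<bar>blinfun_apply f (x j)\<bar>) \<le> 2 * M * norm f"
proof -
  have F: "\<bar>\<Sum>j\<in>B. blinfun_apply f (x j)\<bar> \<le> M * norm f" if B: "finite B" for B
  proof -
    obtain N where N: "B \<subseteq> {..<N}" using B finite_nat_iff_bounded by blast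
    have "norm (\<Sum>j\<in>B. x j) \<le> M"
      using suppression_1_unconditionalD[OF s _ N, of "\<lambda>_. 1"] bd[of N] by simp
    then have "norm f * norm (\<Sum>j\<in>B. x j) \<le> norm f * M" by (intro mult_left_mono) auto
    then show ?thesis using norm_blinfun[of f "\<Sum>j\<in>B. x j"] by (simp add: blinfun.sum_right mult.commute)
  qed
  let ?P = "{j \<in> A. blinfun_apply f (x j) \<ge> 0}" and ?Q = "{j \<in> A. \<not> blinfun_apply f (x j) \<ge> 0}"
  have "(\<Sum>j\<in>A. \<bar>blinfun_apply f (x j)\<bar>) = (\<Sum>j\<in>A. if blinfun_apply f (x j) \<ge> 0 then blinfun_apply f (x j) else - blinfun_apply f (x j))"
    by (intro sum.cong) auto
  also have "\<dots> = (\<Sum>j\<in>?P. blinfun_apply f (x j)) - (\<Sum>j\<in>?Q. blinfun_apply f (x j))"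
    using A by (simp add: sum.If_cases Int_def sum_negf)
  finally show ?thesis using F[of ?P] F[of ?Q] A by simp
qed

text \<open>For the upper estimate, a norming functional reduces the norm to the absolute sums of
  \<open>suppression_1_unconditional_abs_functional_le\<close>, weighted by the largest coefficient.
  Suppressing all but one term gives the lower estimate.\<close>

lemma c0_embeds_if_bounded_partial_sums:
  fixes x :: "nat \<Rightarrow> 'a::banach"
  assumes s: "suppression_1_unconditional x" and bd: "\<And>n. norm (\<Sum>j<n. x j) \<le> M"
    and \<delta>: "\<delta> > 0" "\<And>j. \<delta> \<le> norm (x j)"
  shows "c0_embeds TYPE('a)"
proof -
  have M: "0 \<le> M" using bd[of 0] by simp
  have up: "norm (\<Sum>j\<in>A. a j *\<^sub>R x j) \<le> 2 * M * c" if A: "finite A" and c: "\<And>j. j \<in> A \<Longrightarrow> \<bar>a j\<bar> \<le> c" "0 \<le> c" for A a c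
  proof -
    obtain f :: "'a \<Rightarrow>\<^sub>L real" where f: "norm f \<le> 1" "blinfun_apply f (\<Sum>j\<in>A. a j *\<^sub>R x j) = norm (\<Sum>j\<in>A. a j *\<^sub>R x j)"
      by (rule norming_functional)
    have "norm (\<Sum>j\<in>A. a j *\<^sub>R x j) = (\<Sum>j\<in>A. a j * blinfun_apply f (x j))"
      using f(2) by (simp add: blinfun.sum_right blinfun.scaleR_right)
    also have "\<dots> \<le> (\<Sum>j\<in>A. c * \<bar>blinfun_apply f (x j)\<bar>)"
      using c(1) by (intro sum_mono, rule_tac order_trans[OF abs_ge_self]) (simp add: abs_mult mult_right_mono)
    also have "\<dots> = c * (\<Sum>j\<in>A. \<bar>blinfun_apply f (x j)\<bar>)" by (simp add: sum_distrib_left)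
    also have "\<dots> \<le> c * (2 * M * norm f)"
      by (intro mult_left_mono c(2) suppression_1_unconditional_abs_functional_le[OF s bd A])
    also have "\<dots> \<le> c * (2 * M * 1)" using f(1) c(2) M by (intro mult_left_mono) auto
    finally show ?thesis by (simp add: mult.commute)
  qed
  have summ: "summable (\<lambda>i. a i *\<^sub>R x i)" if a: "a \<longlonglongrightarrow> 0" for a
    unfolding summable_Cauchy
  proof (intro allI impI)
    fix \<epsilon> :: real assume \<epsilon>: "\<epsilon> > 0"
    define c where "c = \<epsilon> / (2 * (2 * M + 1))"
    have c: "c > 0" "2 * M * c < \<epsilon>" using \<epsilon> M by (auto simp: c_def field_simps intro!: add_pos_nonneg)
    obtain N where N: "\<And>n. n \<ge> N \<Longrightarrow> \<bar>a n\<bar> < c" using LIMSEQ_D[OF a c(1)] by auto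
    have "norm (\<Sum>i\<in>{m..<n}. a i *\<^sub>R x i) < \<epsilon>" if "m \<ge> N" for m n
    proof -
      have "norm (\<Sum>i\<in>{m..<n}. a i *\<^sub>R x i) \<le> 2 * M * c"
      proof (rule up)
        show "\<bar>a j\<bar> \<le> c" if "j \<in> {m..<n}" for j using N[of j] that \<open>m \<ge> N\<close> by simp
      qed (use c in auto)
      then show ?thesis using c(2) by simp
    qed
    then show "\<exists>N. \<forall>m\<ge>N. \<forall>n. norm (\<Sum>i\<in>{m..<n}. a i *\<^sub>R x i) < \<epsilon>" by blast
  qed
  have bdd: "bdd_above (range (\<lambda>i. \<bar>a i\<bar>))" if "a \<longlonglongrightarrow> 0" for a :: "nat \<Rightarrow> real"
    using convergent_imp_Bseq[OF convergentI[OF that]] by (auto simp: Bseq_def bdd_above_def)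
  have "isomorphic_embedding {a. a \<longlonglongrightarrow> 0} (\<lambda>a. SUP i. \<bar>a i\<bar>) (\<lambda>a. \<Sum>i. a i *\<^sub>R x i)"
  proof (rule isomorphic_embedding_suminf)
    show "\<delta> > 0" by fact
  next
    fix a :: "nat \<Rightarrow> real" assume "a \<in> {a. a \<longlonglongrightarrow> 0}" then have a: "a \<longlonglongrightarrow> 0" by simp
    show "summable (\<lambda>i. a i *\<^sub>R x i)" by (rule summ[OF a])
    have sm: "(\<lambda>i. a i *\<^sub>R x i) sums (\<Sum>i. a i *\<^sub>R x i)" using summ[OF a] by (rule summable_sums)
    have "(SUP i. \<bar>a i\<bar>) \<le> norm (\<Sum>i. a i *\<^sub>R x i) / \<delta>"
    proof (rule cSUP_least)
      fix j
      have "\<bar>a j\<bar> * \<delta> \<le> \<bar>a j\<bar> * norm (x j)" using \<delta>(2) by (intro mult_left_mono) auto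
      then show "\<bar>a j\<bar> \<le> norm (\<Sum>i. a i *\<^sub>R x i) / \<delta>"
        using suppression_1_unconditional_coeff_le[OF s sm, of j] \<delta>(1) by (simp add: field_simps)
    qed simp
    then show "\<delta> * (SUP i. \<bar>a i\<bar>) \<le> norm (\<Sum>i. a i *\<^sub>R x i)" using \<delta>(1) by (simp add: field_simps)
    have ub: "\<bar>a j\<bar> \<le> (SUP i. \<bar>a i\<bar>)" for j by (rule cSUP_upper[OF _ bdd[OF a]]) simp
    have "0 \<le> (SUP i. \<bar>a i\<bar>)" using ub[of 0] abs_ge_zero order_trans by blast
    then show "norm (\<Sum>i. a i *\<^sub>R x i) \<le> 2 * M * (SUP i. \<bar>a i\<bar>)"
      using ub by (intro tendsto_upperbound[OF tendsto_norm[OF sm[unfolded sums_def]]]) (auto intro!: up always_eventually)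
  qed
  then show ?thesis unfolding c0_embeds_def by blast
qed

text \<open>After suppression to the coefficients of one sign, \<open>f\<close> sees no cancellation
  and detects their absolute sum up to \<open>\<delta>\<close>. Adding both signs costs a factor 2.
  The upper estimate is the triangle inequality.\<close>

lemma l1_embeds_if_functional_bounded_below:
  fixes x :: "nat \<Rightarrow> 'a::banach" and f :: "'a \<Rightarrow>\<^sub>L real"
  assumes s: "suppression_1_unconditional x" and bd: "\<And>j. norm (x j) \<le> K"
    and \<delta>: "\<delta> > 0" "\<And>j. \<delta> \<le> blinfun_apply f (x j)"
  shows "l1_embeds TYPE('a)"
proof -
  have f: "norm f > 0" using \<delta>(1) \<delta>(2)[of 0] by auto
  have low: "\<delta> * (\<Sum>j\<in>A. \<bar>a j\<bar>) \<le> 2 * norm f * norm (\<Sum>j\<in>A. a j *\<^sub>R x j)" if A: "finite A" for A a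
  proof -
    have one: "\<delta> * (\<Sum>j\<in>B. \<sigma> * a j) \<le> norm f * norm (\<Sum>j\<in>A. a j *\<^sub>R x j)"
      if B: "B \<subseteq> A" and \<sigma>: "\<bar>\<sigma>\<bar> = 1" "\<And>j. j \<in> B \<Longrightarrow> 0 \<le> \<sigma> * a j" for B \<sigma>
    proof -
      have "\<delta> * (\<Sum>j\<in>B. \<sigma> * a j) \<le> (\<Sum>j\<in>B. \<sigma> * a j * blinfun_apply f (x j))"
        unfolding sum_distrib_left using \<sigma>(2) \<delta>(2) by (intro sum_mono) (simp add: mult.commute[of \<delta>] mult_left_mono)
      also have "\<dots> = \<sigma> * blinfun_apply f (\<Sum>j\<in>B. a j *\<^sub>R x j)"
        by (simp add: blinfun.sum_right blinfun.scaleR_right sum_distrib_left mult.assoc)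
      also have "\<dots> \<le> \<bar>blinfun_apply f (\<Sum>j\<in>B. a j *\<^sub>R x j)\<bar>"
        using \<sigma>(1) by (metis abs_ge_self abs_mult mult_1)
      also have "\<dots> \<le> norm f * norm (\<Sum>j\<in>B. a j *\<^sub>R x j)" using norm_blinfun[of f] by simp
      also have "\<dots> \<le> norm f * norm (\<Sum>j\<in>A. a j *\<^sub>R x j)"
        using suppression_1_unconditionalD[OF s A B] f by simp
      finally show ?thesis .
    qed
    let ?P = "{j \<in> A. a j \<ge> 0}" and ?Q = "{j \<in> A. \<not> a j \<ge> 0}"
    have "(\<Sum>j\<in>A. \<bar>a j\<bar>) = (\<Sum>j\<in>A. if a j \<ge> 0 then 1 * a j else - 1 * a j)"
      by (intro sum.cong) auto
    also have "\<dots> = (\<Sum>j\<in>?P. 1 * a j) + (\<Sum>j\<in>?Q. - 1 * a j)"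
      using A by (simp only: sum.If_cases Int_def mem_Collect_eq) (simp add: Collect_neg_eq)
    finally show ?thesis using one[of ?P 1] one[of ?Q "-1"] by (simp add: distrib_left)
  qed
  have nsumm: "summable (\<lambda>i. norm (a i *\<^sub>R x i))" if "summable (\<lambda>i. \<bar>a i\<bar>)" for a
    by (rule summable_comparison_test'[OF summable_mult2[OF that, of K], of 0])
      (auto intro!: mult_left_mono bd)
  have "isomorphic_embedding {a. summable (\<lambda>i. \<bar>a i\<bar>)} (\<lambda>a. \<Sum>i. \<bar>a i\<bar>) (\<lambda>a. \<Sum>i. a i *\<^sub>R x i)"
  proof (rule isomorphic_embedding_suminf)
    show "\<delta> / (2 * norm f) > 0" using \<delta> f by simp
  next
    fix a :: "nat \<Rightarrow> real" assume "a \<in> {a. summable (\<lambda>i. \<bar>a i\<bar>)}"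
    then have a: "summable (\<lambda>i. \<bar>a i\<bar>)" by simp
    show sm: "summable (\<lambda>i. a i *\<^sub>R x i)" by (rule summable_norm_cancel[OF nsumm[OF a]])
    have "\<delta> * (\<Sum>i. \<bar>a i\<bar>) \<le> 2 * norm f * norm (\<Sum>i. a i *\<^sub>R x i)"
    proof (rule LIMSEQ_le)
      show "(\<lambda>n. \<delta> * (\<Sum>i<n. \<bar>a i\<bar>)) \<longlonglongrightarrow> \<delta> * (\<Sum>i. \<bar>a i\<bar>)"
        by (intro tendsto_intros summable_LIMSEQ a)
      show "(\<lambda>n. 2 * norm f * norm (\<Sum>i<n. a i *\<^sub>R x i)) \<longlonglongrightarrow> 2 * norm f * norm (\<Sum>i. a i *\<^sub>R x i)"
        by (intro tendsto_intros summable_LIMSEQ sm)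
    qed (use low in auto)
    then show "\<delta> / (2 * norm f) * (\<Sum>i. \<bar>a i\<bar>) \<le> norm (\<Sum>i. a i *\<^sub>R x i)"
      using f by (simp add: field_simps)
    have "norm (\<Sum>i. a i *\<^sub>R x i) \<le> (\<Sum>i. norm (a i *\<^sub>R x i))" by (rule summable_norm[OF nsumm[OF a]])
    also have "\<dots> \<le> (\<Sum>i. \<bar>a i\<bar> * K)"
      by (intro suminf_le nsumm a summable_mult2) (auto intro!: mult_left_mono bd)
    finally show "norm (\<Sum>i. a i *\<^sub>R x i) \<le> K * (\<Sum>i. \<bar>a i\<bar>)"
      using suminf_mult[OF a, of K] by (simp add: mult.commute)
  qed
  then show ?thesis unfolding l1_embeds_def by blast
qed

subsection \<open>Spreading bases\<close>

lemma sums_coord: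
  assumes "schauder_basis b"
  shows "(\<lambda>i. coord b x i *\<^sub>R b i) sums x"
proof -
  have "\<exists>!a. (\<lambda>i. a i *\<^sub>R b i) sums x" using assms by (simp add: schauder_basis_of_def)
  then show ?thesis unfolding coord_def by (rule theI')
qed

lemma coord_eqI:
  assumes "schauder_basis b" "(\<lambda>i. a i *\<^sub>R b i) sums x"
  shows "coord b x = a"
  using assms sums_coord[OF assms(1)] unfolding schauder_basis_of_def by blast

lemma coord_sum_scaleR:
  assumes "schauder_basis b" "finite A"
  shows "coord b (\<Sum>i\<in>A. a i *\<^sub>R b i) = (\<lambda>i. if i \<in> A then a i else 0)"
proof (rule coord_eqI[OF assms(1)])
  show "(\<lambda>i. (if i \<in> A then a i else 0) *\<^sub>R b i) sums (\<Sum>i\<in>A. a i *\<^sub>R b i)"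
    using sums_If_finite_set[OF assms(2), of "\<lambda>i. a i *\<^sub>R b i"]
    by (rule back_subst[of "\<lambda>f. f sums _"]) auto
qed

lemma coord_add:
  assumes "schauder_basis b"
  shows "coord b (x + y) i = coord b x i + coord b y i"
proof -
  have "coord b (x + y) = (\<lambda>i. coord b x i + coord b y i)"
    by (rule coord_eqI[OF assms]) (use sums_add[OF sums_coord[OF assms] sums_coord[OF assms]] in \<open>simp add: scaleR_add_left\<close>)
  then show ?thesis by simp
qed

lemma coord_scaleR:
  assumes "schauder_basis b"
  shows "coord b (c *\<^sub>R x) i = c * coord b x i"
proof -
  have "coord b (c *\<^sub>R x) = (\<lambda>i. c * coord b x i)"
    by (rule coord_eqI[OF assms]) (use sums_scaleR_right[OF sums_coord[OF assms], of c x] in simp)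
  then show ?thesis by simp
qed

lemma sum_coord_eq:
  assumes "schauder_basis b" "finite A" "\<And>i. i \<notin> A \<Longrightarrow> coord b x i = 0"
  shows "(\<Sum>i\<in>A. coord b x i *\<^sub>R b i) = x"
proof -
  have "(\<lambda>i. coord b x i *\<^sub>R b i) sums (\<Sum>i\<in>A. coord b x i *\<^sub>R b i)"
    by (rule sums_finite) (use assms in auto)
  then show ?thesis using sums_coord[OF assms(1)] sums_unique2 by blast
qed

locale spreading_basis =
  fixes e :: "nat \<Rightarrow> 'a::banach"
  assumes basis: "schauder_basis e"
    and normalized: "normalized e"
    and spreading: "one_spreading e"
    and bimonotone: "bimonotone e"
    and not_weakly_null: "\<not> weakly_null e"
begin

lemma norm_basis [simp]: "norm (e i) = 1"
  using normalized by (simp add: normalized_def)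

lemma norm_sum_interval_le:
  assumes "\<And>i k. i \<in> I \<Longrightarrow> k \<in> I \<Longrightarrow> {i..k} \<subseteq> I" "finite I"
  shows "norm (\<Sum>i\<in>I. coord e x i *\<^sub>R e i) \<le> norm x"
proof -
  have "basis_projection e I x = (\<Sum>i\<in>I. (if i \<in> I then coord e x i else 0) *\<^sub>R e i)"
    unfolding basis_projection_def by (rule suminf_finite) (use assms in auto)
  moreover have "\<forall>i\<in>I. \<forall>k\<in>I. {i..k} \<subseteq> I" using assms(1) by blast
  then have "norm (basis_projection e I x) \<le> norm x" using bimonotone unfolding bimonotone_def by blast
  ultimately show ?thesis by simp
qed

lemma norm_sum_atLeastLessThan_le: "norm (\<Sum>i\<in>{m..<n}. coord e x i *\<^sub>R e i) \<le> norm x"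
  by (rule norm_sum_interval_le) auto

lemma norm_sum_lessThan_le: "norm (\<Sum>i<n. coord e x i *\<^sub>R e i) \<le> norm x"
  by (rule norm_sum_interval_le) auto

lemma abs_coord_le: "\<bar>coord e x i\<bar> \<le> norm x"
  using norm_sum_interval_le[of "{i}" x] by simp

lemma norm_sum_atLeastLessThan_le_sum:
  assumes "finite A" "{m..<n} \<subseteq> A"
  shows "norm (\<Sum>i\<in>{m..<n}. a i *\<^sub>R e i) \<le> norm (\<Sum>i\<in>A. a i *\<^sub>R e i)"
proof -
  have "(\<Sum>i\<in>{m..<n}. coord e (\<Sum>i\<in>A. a i *\<^sub>R e i) i *\<^sub>R e i) = (\<Sum>i\<in>{m..<n}. a i *\<^sub>R e i)"
    using assms by (intro sum.cong) (auto simp: coord_sum_scaleR[OF basis])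
  then show ?thesis using norm_sum_atLeastLessThan_le[of "\<Sum>i\<in>A. a i *\<^sub>R e i" m n] by simp
qed

lemma bounded_linear_coord: "bounded_linear (\<lambda>x. coord e x i)"
  by (rule bounded_linear_intro[of _ 1]) (use abs_coord_le in \<open>auto simp: coord_add[OF basis] coord_scaleR[OF basis]\<close>)

text \<open>The functional biorthogonal to the basis, built from coordinates so that boundedness is
  at hand; \<open>biorthogonal_eq\<close> identifies it with the one given by definite
  description.\<close>

definition coord_fun :: "nat \<Rightarrow> 'a \<Rightarrow>\<^sub>L real" where
  "coord_fun i = Blinfun (\<lambda>x. coord e x i)"

lemma coord_fun_apply [simp]: "blinfun_apply (coord_fun i) x = coord e x i"
  by (simp add: coord_fun_def bounded_linear_Blinfun_apply bounded_linear_coord)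

lemma coord_basis: "coord e (e j) i = (if i = j then 1 else 0)"
  using coord_sum_scaleR[OF basis, of "{j}" "\<lambda>_. 1"] by simp

lemma coord_0 [simp]: "coord e 0 i = 0"
  using coord_scaleR[OF basis, of 0 0 i] by simp

lemma coord_sum: "coord e (\<Sum>j\<in>A. f j) i = (\<Sum>j\<in>A. coord e (f j) i)"
  using blinfun.sum_right[of "coord_fun i" f A] by simp

lemma coord_diff: "coord e (x - y) i = coord e x i - coord e y i"
  using blinfun.diff_right[of "coord_fun i" x y] by simp

lemma eq_if_coord_eq: "(\<And>i. coord e x i = coord e y i) \<Longrightarrow> x = y"
  using sums_coord[OF basis, of x] sums_coord[OF basis, of y] sums_unique2 by (metis (no_types, lifting) sums_cong)

lemma blinfun_eq_if_basis_eq: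
  fixes f g :: "'a \<Rightarrow>\<^sub>L real"
  assumes "\<And>i. blinfun_apply f (e i) = blinfun_apply g (e i)"
  shows "f = g"
proof (rule blinfun_eqI)
  fix x
  have "(\<lambda>i. blinfun_apply h (coord e x i *\<^sub>R e i)) sums blinfun_apply h x" for h :: "'a \<Rightarrow>\<^sub>L real"
    by (rule bounded_linear.sums[OF blinfun.bounded_linear_right sums_coord[OF basis]])
  from this[of f] this[of g] show "blinfun_apply f x = blinfun_apply g x"
    using assms by (simp add: blinfun.scaleR_right sums_unique2)
qed

lemma biorthogonal_eq: "biorthogonal e i = coord_fun i"
  unfolding biorthogonal_def
proof (rule the_equality)
  show "\<forall>j. blinfun_apply (coord_fun i) (e j) = (if i = j then 1 else 0)" by (simp add: coord_basis)
next
  fix f :: "'a \<Rightarrow>\<^sub>L real" assume "\<forall>j. blinfun_apply f (e j) = (if i = j then 1 else 0)"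
  then show "f = coord_fun i" by (intro blinfun_eq_if_basis_eq) (simp add: coord_basis)
qed

lemma norm_spread:
  assumes A: "finite A" and n: "strict_mono n"
  shows "norm (\<Sum>i\<in>A. a i *\<^sub>R e (n i)) = norm (\<Sum>i\<in>A. a i *\<^sub>R e i)"
proof -
  define b where "b i = (if i \<in> A then a i else 0)" for i
  have "finite {i. b i \<noteq> 0}" by (rule finite_subset[OF _ A]) (auto simp: b_def)
  then have "norm (\<Sum>i | b i \<noteq> 0. b i *\<^sub>R e i) = norm (\<Sum>i | b i \<noteq> 0. b i *\<^sub>R e (n i))"
    using spreading n by (simp add: one_spreading_def)
  moreover have "(\<Sum>i | b i \<noteq> 0. b i *\<^sub>R g i) = (\<Sum>i\<in>A. a i *\<^sub>R g i)" for g :: "nat \<Rightarrow> 'a"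
    using A by (intro sum.mono_neutral_cong_left) (auto simp: b_def)
  ultimately show ?thesis by simp
qed

text \<open>A functional \<open>f\<close> that does not tend to 0 along the basis converges to some
  \<open>c \<noteq> 0\<close> along a subsequence. Spreading a finite combination along that
  subsequence keeps its norm, while the value of \<open>f\<close> there approaches \<open>c\<close>
  times the coefficient sum. Hence the constant \<open>norm f / \<bar>c\<bar>\<close>.\<close>

lemma sum_coeffs_bounded:
  "\<exists>C\<ge>0. \<forall>A a. finite A \<longrightarrow> \<bar>\<Sum>i\<in>A. a i\<bar> \<le> C * norm (\<Sum>i\<in>A. a i *\<^sub>R e i)"
proof -
  obtain f :: "'a \<Rightarrow>\<^sub>L real" where f: "\<not> (\<lambda>i. blinfun_apply f (e i)) \<longlonglongrightarrow> 0"
    using not_weakly_null by (auto simp: weakly_null_def)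
  then obtain \<epsilon> where \<epsilon>: "\<epsilon> > 0" and fr: "\<forall>N. \<exists>n\<ge>N. \<epsilon> \<le> \<bar>blinfun_apply f (e n)\<bar>"
    unfolding LIMSEQ_iff by (auto simp: not_less)
  have "infinite {n. \<epsilon> \<le> \<bar>blinfun_apply f (e n)\<bar>}"
    using fr by (auto simp: infinite_nat_iff_unbounded_le)
  then obtain r :: "nat \<Rightarrow> nat" where r: "strict_mono r" "\<And>k. \<epsilon> \<le> \<bar>blinfun_apply f (e (r k))\<bar>"
    using infinite_enumerate by (metis (mono_tags, lifting) mem_Collect_eq)
  have "bounded (range (\<lambda>k. blinfun_apply f (e (r k))))"
    using norm_blinfun[of f "e _"] by (auto simp: bounded_iff intro!: exI[of _ "norm f"])
  then obtain c s where s: "strict_mono (s :: nat \<Rightarrow> nat)" "((\<lambda>k. blinfun_apply f (e (r k))) \<circ> s) \<longlonglongrightarrow> c"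
    using bounded_imp_convergent_subsequence by blast
  have c: "\<epsilon> \<le> \<bar>c\<bar>"
    by (rule tendsto_lowerbound[OF tendsto_rabs[OF s(2)]]) (use r(2) in auto)
  define C where "C = norm f / \<bar>c\<bar>"
  have "\<bar>\<Sum>i\<in>A. a i\<bar> \<le> C * norm (\<Sum>i\<in>A. a i *\<^sub>R e i)" if A: "finite A" for A a
  proof -
    have "\<bar>\<Sum>i\<in>A. a i * c\<bar> \<le> norm f * norm (\<Sum>i\<in>A. a i *\<^sub>R e i)"
    proof (rule tendsto_upperbound)
      \<comment> \<open>Shifting by a common \<open>k\<close> sends all the finitely many vectors to
        infinity at once and keeps their order, so each shift is a spread.\<close>
      have "(\<lambda>k. blinfun_apply f (e (r (s (i + k))))) \<longlonglongrightarrow> c" for i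
        using LIMSEQ_ignore_initial_segment[OF s(2), of i] by (simp add: add.commute)
      then show "(\<lambda>k. \<bar>\<Sum>i\<in>A. a i * blinfun_apply f (e (r (s (i + k))))\<bar>) \<longlonglongrightarrow> \<bar>\<Sum>i\<in>A. a i * c\<bar>"
        by (intro tendsto_intros)
      have "\<bar>\<Sum>i\<in>A. a i * blinfun_apply f (e (r (s (i + k))))\<bar> \<le> norm f * norm (\<Sum>i\<in>A. a i *\<^sub>R e i)" for k
      proof -
        have "strict_mono (\<lambda>i. r (s (i + k)))" using r(1) s(1) by (simp add: strict_mono_def)
        from norm_spread[OF A this, of a] norm_blinfun[of f "\<Sum>i\<in>A. a i *\<^sub>R e (r (s (i + k)))"]
        show ?thesis by (simp add: blinfun.sum_right blinfun.scaleR_right)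
      qed
      then show "\<forall>\<^sub>F k in sequentially. \<bar>\<Sum>i\<in>A. a i * blinfun_apply f (e (r (s (i + k))))\<bar> \<le> norm f * norm (\<Sum>i\<in>A. a i *\<^sub>R e i)"
        by simp
    qed simp
    then have "\<bar>\<Sum>i\<in>A. a i\<bar> * \<bar>c\<bar> \<le> norm f * norm (\<Sum>i\<in>A. a i *\<^sub>R e i)"
      by (simp add: abs_mult flip: sum_distrib_right)
    then show ?thesis using \<epsilon> c by (simp add: C_def field_simps)
  qed
  moreover have "0 \<le> C" by (simp add: C_def)
  ultimately show ?thesis by blast
qed

lemma summable_coord: "summable (coord e x)"
proof -
  obtain C where C: "0 \<le> C" "\<And>A a. finite A \<Longrightarrow> \<bar>\<Sum>i\<in>A. a i\<bar> \<le> C * norm (\<Sum>i\<in>A. a i *\<^sub>R e i)"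
    using sum_coeffs_bounded by blast
  show ?thesis
    unfolding summable_Cauchy
  proof (intro allI impI)
    fix \<epsilon> :: real assume \<epsilon>: "\<epsilon> > 0"
    then have "\<epsilon> / (C + 1) > 0" using C(1) by simp
    then obtain N where N: "\<And>m n. m \<ge> N \<Longrightarrow> norm (\<Sum>i\<in>{m..<n}. coord e x i *\<^sub>R e i) < \<epsilon> / (C + 1)"
      using sums_summable[OF sums_coord[OF basis, of x]] unfolding summable_Cauchy by blast
    have "norm (\<Sum>i\<in>{m..<n}. coord e x i) < \<epsilon>" if "m \<ge> N" for m n
    proof -
      have "norm (\<Sum>i\<in>{m..<n}. coord e x i) \<le> (C + 1) * norm (\<Sum>i\<in>{m..<n}. coord e x i *\<^sub>R e i)"
        using C(2)[of "{m..<n}" "coord e x"] by (simp add: distrib_right add_increasing2)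
      also have "\<dots> < (C + 1) * (\<epsilon> / (C + 1))" using N[OF that, of n] C(1) by (intro mult_strict_left_mono) auto
      finally show ?thesis using C(1) by simp
    qed
    then show "\<exists>N. \<forall>m\<ge>N. \<forall>n. norm (\<Sum>i\<in>{m..<n}. coord e x i) < \<epsilon>" by blast
  qed
qed

lemma bounded_linear_summing_functional: "bounded_linear (summing_functional e)"
proof -
  obtain C where C: "0 \<le> C" "\<And>A a. finite A \<Longrightarrow> \<bar>\<Sum>i\<in>A. a i\<bar> \<le> C * norm (\<Sum>i\<in>A. a i *\<^sub>R e i)"
    using sum_coeffs_bounded by blast
  show ?thesis
  proof (rule bounded_linear_intro[of _ C])
    show "summing_functional e (x + y) = summing_functional e x + summing_functional e y" for x y
      by (simp add: summing_functional_def coord_add[OF basis] suminf_add summable_coord)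
    show "summing_functional e (c *\<^sub>R x) = c *\<^sub>R summing_functional e x" for c x
      by (simp add: summing_functional_def coord_scaleR[OF basis] suminf_mult summable_coord)
    show "norm (summing_functional e x) \<le> norm x * C" for x
      unfolding summing_functional_def
    proof (rule tendsto_upperbound[OF tendsto_norm[OF summable_LIMSEQ[OF summable_coord]]])
      have "norm (\<Sum>i<n. coord e x i) \<le> norm x * C" for n
        using C(2)[of "{..<n}" "coord e x"] mult_left_mono[OF norm_sum_lessThan_le[of x n] C(1)] by (simp add: mult.commute)
      then show "\<forall>\<^sub>F n in sequentially. norm (\<Sum>i<n. coord e x i) \<le> norm x * C" by simp
    qed simp
  qed
qed

definition sum_fun :: "'a \<Rightarrow>\<^sub>L real" where
  "sum_fun = Blinfun (summing_functional e)"

lemma sum_fun_apply: "blinfun_apply sum_fun = summing_functional e"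
  by (simp add: sum_fun_def bounded_linear_Blinfun_apply bounded_linear_summing_functional)

lemma sum_fun_basis [simp]: "blinfun_apply sum_fun (e i) = 1"
proof -
  have "(\<Sum>j. coord e (e i) j) = (\<Sum>j\<in>{i}. coord e (e i) j)" by (rule suminf_finite) (auto simp: coord_basis)
  then show ?thesis by (simp add: sum_fun_apply summing_functional_def coord_basis)
qed

lemma sum_fun_sum: "blinfun_apply sum_fun (\<Sum>i\<in>A. a i *\<^sub>R e i) = (\<Sum>i\<in>A. a i)"
  by (simp add: blinfun.sum_right blinfun.scaleR_right)

text \<open>Windows of length \<open>N\<close> starting at neighbouring indices differ by only two
  unit vectors. The error therefore depends on the displacement \<open>i\<close> and not on
  \<open>N\<close>.\<close>

lemma norm_telescope_le: "norm ((\<Sum>s<N. e (i + s)) - (\<Sum>s<N. e s)) \<le> 2 * real i"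
proof (induction i)
  case (Suc i)
  have "(\<Sum>s<N. e (Suc i + s)) - (\<Sum>s<N. e (i + s)) = e (i + N) - e i"
    using sum_lessThan_telescope[of "\<lambda>s. e (i + s)" N] by (simp add: sum_subtractf)
  then have eq: "(\<Sum>s<N. e (Suc i + s)) - (\<Sum>s<N. e s) = (\<Sum>s<N. e (i + s)) - (\<Sum>s<N. e s) + (e (i + N) - e i)"
    by (simp add: algebra_simps)
  have "norm (e (i + N) - e i) \<le> 2" using norm_triangle_ineq4[of "e (i + N)" "e i"] by simp
  then show ?case unfolding eq using Suc norm_triangle_ineq[of "(\<Sum>s<N. e (i + s)) - (\<Sum>s<N. e s)" "e (i + N) - e i"] by simp
qed simp

text \<open>The indices from \<open>r\<close> on are moved out of the way by \<open>N\<close>, so that the block on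
  \<open>{q..<r}\<close> can be averaged over its first \<open>N\<close> translates. Its coefficients telescope away,
  up to an error independent of \<open>N\<close>.\<close>

lemma norm_sum_remove_block_le:
  assumes A: "finite A" and zero: "(\<Sum>i\<in>A \<inter> {q..<r}. a i) = 0"
  shows "norm (\<Sum>i\<in>A - {q..<r}. a i *\<^sub>R e i) \<le> norm (\<Sum>i\<in>A. a i *\<^sub>R e i)"
proof -
  let ?B = "A \<inter> {q..<r}" and ?R = "A - {q..<r}"
  define D where "D = (\<Sum>i\<in>?B. \<bar>a i\<bar> * (2 * real i))"
  have main: "real N * norm (\<Sum>i\<in>?R. a i *\<^sub>R e i) \<le> real N * norm (\<Sum>i\<in>A. a i *\<^sub>R e i) + D" for N
  proof -
    \<comment> \<open>For each \<open>s \<le> N\<close> this is strictly increasing, and outside the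
      block it does not depend on \<open>s\<close> on the indices that occur. Summing over
      \<open>s < N\<close> thus moves only the block.\<close>
    define n where "n s i = (if i < q then i else if i < r then i + s else i + N)" for s i
    have mono: "strict_mono (n s)" if "s \<le> N" for s
      using that by (auto simp: strict_mono_def n_def)
    define z where "z = (\<Sum>i\<in>?R. a i *\<^sub>R e (n N i))"
    define w where "w = (\<Sum>i\<in>?B. a i *\<^sub>R ((\<Sum>s<N. e (i + s)) - (\<Sum>s<N. e s)))"
    have "(\<Sum>s<N. \<Sum>i\<in>A. a i *\<^sub>R e (n s i)) = (\<Sum>i\<in>A. a i *\<^sub>R (\<Sum>s<N. e (n s i)))"
      by (subst sum.swap) (simp add: scaleR_sum_right)
    also have "\<dots> = (\<Sum>i\<in>?R. a i *\<^sub>R (\<Sum>s<N. e (n s i))) + (\<Sum>i\<in>?B. a i *\<^sub>R (\<Sum>s<N. e (n s i)))"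
      using sum.Int_Diff[OF A, of _ "{q..<r}"] by (simp add: add.commute)
    also have "(\<Sum>i\<in>?R. a i *\<^sub>R (\<Sum>s<N. e (n s i))) = real N *\<^sub>R z"
      unfolding z_def scaleR_sum_right
    proof (rule sum.cong)
      fix i assume "i \<in> ?R"
      then have "(\<Sum>s<N. e (n s i)) = (\<Sum>s<N. e (n N i))" by (intro sum.cong) (auto simp: n_def)
      then show "(\<Sum>s<N. a i *\<^sub>R e (n s i)) = real N *\<^sub>R a i *\<^sub>R e (n N i)"
        by (simp add: scaleR_sum_right[symmetric] sum_constant_scaleR)
    qed simp
    also have "(\<Sum>i\<in>?B. a i *\<^sub>R (\<Sum>s<N. e (n s i))) = (\<Sum>i\<in>?B. a i *\<^sub>R (\<Sum>s<N. e (i + s)))"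
      by (intro sum.cong arg_cong2[of _ _ _ _ scaleR]) (auto simp: n_def)
    \<comment> \<open>Subtracting the common window \<open>(\<Sum>s<N. e s)\<close> from every term
      changes nothing, because the coefficients on the block sum to zero.\<close>
    also have "\<dots> = w"
      using zero by (simp add: w_def scaleR_diff_right sum_subtractf flip: scaleR_sum_left)
    finally have "real N *\<^sub>R z = (\<Sum>s<N. \<Sum>i\<in>A. a i *\<^sub>R e (n s i)) - w" by simp
    then have "real N * norm z = norm ((\<Sum>s<N. \<Sum>i\<in>A. a i *\<^sub>R e (n s i)) - w)"
      by (metis norm_scaleR abs_of_nat)
    also have "\<dots> \<le> norm (\<Sum>s<N. \<Sum>i\<in>A. a i *\<^sub>R e (n s i)) + norm w" by (rule norm_triangle_ineq4)
    also have "norm (\<Sum>s<N. \<Sum>i\<in>A. a i *\<^sub>R e (n s i)) \<le> (\<Sum>s<N. norm (\<Sum>i\<in>A. a i *\<^sub>R e i))"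
      by (rule order_trans[OF norm_sum]) (intro sum_mono, simp add: norm_spread[OF A mono])
    also have "norm w \<le> D"
      unfolding w_def D_def by (rule order_trans[OF norm_sum]) (intro sum_mono, simp add: mult_left_mono norm_telescope_le)
    finally show ?thesis
      using norm_spread[OF _ mono[of N], of ?R a] A by (simp add: z_def)
  qed
  show ?thesis
  proof (rule ccontr)
    assume "\<not> ?thesis"
    \<comment> \<open>A positive excess would, by \<open>main\<close>, be at most
      \<open>D / N\<close> for every positive \<open>N\<close>, while \<open>D\<close> is
      fixed.\<close>
    then have pos: "norm (\<Sum>i\<in>?R. a i *\<^sub>R e i) - norm (\<Sum>i\<in>A. a i *\<^sub>R e i) > 0" by simp
    obtain N where "D < real N * (norm (\<Sum>i\<in>?R. a i *\<^sub>R e i) - norm (\<Sum>i\<in>A. a i *\<^sub>R e i))"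
      using reals_Archimedean3[OF pos] by blast
    then show False using main[of N] by (simp add: right_diff_distrib)
  qed
qed

lemma tendsto_partial_sums: "(\<lambda>n. \<Sum>i<n. coord e x i *\<^sub>R e i) \<longlonglongrightarrow> x"
  using sums_coord[OF basis] by (simp add: sums_def)

lemma norm_remove_block_le:
  assumes zero: "(\<Sum>i\<in>{q..<r}. coord e x i) = 0"
  shows "norm (x - (\<Sum>i\<in>{q..<r}. coord e x i *\<^sub>R e i)) \<le> norm x"
proof (rule tendsto_upperbound)
  let ?v = "\<Sum>i\<in>{q..<r}. coord e x i *\<^sub>R e i"
  show "(\<lambda>n. norm ((\<Sum>i<n. coord e x i *\<^sub>R e i) - ?v)) \<longlonglongrightarrow> norm (x - ?v)"
    by (intro tendsto_intros tendsto_partial_sums)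
  have "norm ((\<Sum>i<n. coord e x i *\<^sub>R e i) - ?v) \<le> norm x" if "n \<ge> r" for n
  proof -
    have sub: "{q..<r} \<subseteq> {..<n}" using that by auto
    have int: "{..<n} \<inter> {q..<r} = {q..<r}" using sub by auto
    have "(\<Sum>i<n. coord e x i *\<^sub>R e i) - ?v = (\<Sum>i\<in>{..<n} - {q..<r}. coord e x i *\<^sub>R e i)"
      using sub by (simp add: sum_diff)
    then show ?thesis
      using norm_sum_remove_block_le[where A = "{..<n}" and q = q and r = r and a = "coord e x"] zero norm_sum_lessThan_le[of x n] int by simp
  qed
  then show "\<forall>\<^sub>F n in sequentially. norm ((\<Sum>i<n. coord e x i *\<^sub>R e i) - ?v) \<le> norm x"
    by (auto simp: eventually_sequentially)
qed simp

lemma norm_remove_initial_le: "norm (x - (\<Sum>i<m. coord e x i *\<^sub>R e i)) \<le> norm x"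
proof (rule tendsto_upperbound)
  show "(\<lambda>n. norm ((\<Sum>i<n. coord e x i *\<^sub>R e i) - (\<Sum>i<m. coord e x i *\<^sub>R e i))) \<longlonglongrightarrow> norm (x - (\<Sum>i<m. coord e x i *\<^sub>R e i))"
    by (intro tendsto_intros tendsto_partial_sums)
  have "norm ((\<Sum>i<n. coord e x i *\<^sub>R e i) - (\<Sum>i<m. coord e x i *\<^sub>R e i)) \<le> norm x" if "n \<ge> m" for n
    using norm_sum_atLeastLessThan_le[of x m n] sum_diff_nat_ivl[of 0 m n "\<lambda>i. coord e x i *\<^sub>R e i"] that
    by (simp add: atLeast0LessThan)
  then show "\<forall>\<^sub>F n in sequentially. norm ((\<Sum>i<n. coord e x i *\<^sub>R e i) - (\<Sum>i<m. coord e x i *\<^sub>R e i)) \<le> norm x"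
    by (auto simp: eventually_sequentially)
qed simp

definition blocks :: "(nat \<Rightarrow> 'a) \<Rightarrow> (nat \<Rightarrow> nat) \<Rightarrow> bool" where
  "blocks x q \<longleftrightarrow> strict_mono q \<and> (\<forall>j i. i \<notin> {q j..<q (Suc j)} \<longrightarrow> coord e (x j) i = 0)"

lemma blocks_eq_sum: "blocks x q \<Longrightarrow> (\<Sum>i\<in>{q j..<q (Suc j)}. coord e (x j) i *\<^sub>R e i) = x j"
  unfolding blocks_def by (intro sum_coord_eq[OF basis]) auto

lemma blocks_coord_other:
  assumes "blocks x q" "i \<in> {q k..<q (Suc k)}" "j \<noteq> k"
  shows "coord e (x j) i = 0"
proof -
  have m: "mono q" using assms(1) by (simp add: blocks_def strict_mono_mono)
  have "i \<notin> {q j..<q (Suc j)}"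
  proof (cases "j < k")
    case True
    then have "q (Suc j) \<le> q k" using m by (simp add: monoD)
    then show ?thesis using assms(2) by auto
  next
    case False
    then have "q (Suc k) \<le> q j" using m assms(3) by (simp add: monoD)
    then show ?thesis using assms(2) by auto
  qed
  then show ?thesis using assms(1) by (simp add: blocks_def)
qed

text \<open>Deleting one block leaves a combination of the same blocks, so the deletions can be
  iterated over a finite set. Block 0 is exempt from the sum condition with the difference sequence
  in mind: nothing precedes it, and deleting it leaves a tail of the expansion.\<close>

lemma suppression_1_unconditional_blocks:
  assumes b: "blocks x q" and zero: "\<And>j. j \<noteq> 0 \<Longrightarrow> blinfun_apply sum_fun (x j) = 0"
  shows "suppression_1_unconditional x"
  unfolding suppression_1_unconditional_iff
proof (intro allI impI)
  fix a :: "nat \<Rightarrow> real" and A F :: "nat set" assume A: "finite A" and F: "F \<subseteq> A"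
  have step: "norm (\<Sum>j\<in>B - {k}. a j *\<^sub>R x j) \<le> norm (\<Sum>j\<in>B. a j *\<^sub>R x j)" if B: "finite B" for B k
  proof (cases "k \<in> B")
    case True
    define y where "y = (\<Sum>j\<in>B. a j *\<^sub>R x j)"
    have cy: "coord e y i = a k * coord e (x k) i" if i: "i \<in> {q k..<q (Suc k)}" for i
    proof -
      have "coord e y i = (\<Sum>j\<in>B. a j * coord e (x j) i)" by (simp add: y_def coord_sum coord_scaleR[OF basis])
      also have "\<dots> = (\<Sum>j\<in>{k}. a j * coord e (x j) i)"
        using True B blocks_coord_other[OF b i] by (intro sum.mono_neutral_right) auto
      finally show ?thesis by simp
    qed
    have xk: "(\<Sum>i\<in>{q k..<q (Suc k)}. coord e y i *\<^sub>R e i) = a k *\<^sub>R x k"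
      using blocks_eq_sum[OF b, of k] by (simp add: cy scaleR_sum_right[symmetric] flip: scaleR_scaleR)
    have y: "(\<Sum>j\<in>B - {k}. a j *\<^sub>R x j) = y - a k *\<^sub>R x k"
      using True B by (simp add: y_def sum_diff1)
    show ?thesis
    proof (cases "k = 0")
      case False
      have "blinfun_apply sum_fun (a k *\<^sub>R x k) = 0" using zero[OF False] by (simp add: blinfun.scaleR_right)
      then have "(\<Sum>i\<in>{q k..<q (Suc k)}. coord e y i) = 0" by (simp add: xk[symmetric] sum_fun_sum)
      from norm_remove_block_le[OF this] show ?thesis unfolding y y_def[symmetric] xk .
    next
      case True
      \<comment> \<open>No block reaches below \<open>q 0\<close>, so the initial segment up to
        \<open>q (Suc 0)\<close> is exactly the contribution of block 0.\<close>
      have "coord e y i = 0" if "i < q 0" for i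
      proof -
        have "coord e (x j) i = 0" for j
        proof -
          have "q 0 \<le> q j" using b by (simp add: blocks_def strict_mono_less_eq)
          then show ?thesis using b that by (simp add: blocks_def)
        qed
        then show ?thesis by (simp add: y_def coord_sum coord_scaleR[OF basis])
      qed
      then have "(\<Sum>i<q (Suc 0). coord e y i *\<^sub>R e i) = (\<Sum>i\<in>{q 0..<q (Suc 0)}. coord e y i *\<^sub>R e i)"
        by (intro sum.mono_neutral_right) auto
      then show ?thesis using norm_remove_initial_le[of y "q (Suc 0)"] xk True unfolding y y_def[symmetric] by simp
    qed
  qed simp
  have "norm (\<Sum>j\<in>A - R. a j *\<^sub>R x j) \<le> norm (\<Sum>j\<in>A. a j *\<^sub>R x j)" if "finite R" for R
    using that
  proof (induction R)
    case (insert k R)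
    have "A - insert k R = (A - R) - {k}" by auto
    then show ?case using step[of "A - R" k] A insert by simp
  qed simp
  moreover have "A - (A - F) = F" using F by auto
  ultimately show "norm (\<Sum>j\<in>F. a j *\<^sub>R x j) \<le> norm (\<Sum>j\<in>A. a j *\<^sub>R x j)" using A by (metis finite_Diff)
qed

subsection \<open>The difference sequence\<close>

lemma blocks_if_block_basis:
  assumes "block_basis e x"
  shows "\<exists>q. blocks x q"
proof -
  obtain p a where p: "strict_mono p" and x: "\<And>j. x j = (\<Sum>i\<in>{p j..<p (Suc j)}. a i *\<^sub>R e i)"
    using assms by (auto simp: block_basis_def)
  have "blocks x p" unfolding blocks_def x using p by (auto simp: coord_sum_scaleR[OF basis])
  then show ?thesis by blast
qed

theorem suppression_1_unconditional_block_basis: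
  assumes "block_basis e x" "\<And>i. summing_functional e (x i) = 0"
  shows "suppression_1_unconditional x"
  using blocks_if_block_basis[OF assms(1)] suppression_1_unconditional_blocks assms(2) by (auto simp: sum_fun_apply)

abbreviation d :: "nat \<Rightarrow> 'a" where
  "d \<equiv> difference_sequence e"

text \<open>Abel summation. The boundary term \<open>b n *\<^sub>R e n\<close> is harmless in the
  limit exactly when \<open>b\<close> tends to 0.\<close>

lemma sum_difference_sequence:
  "(\<Sum>i<Suc n. b i *\<^sub>R d i) = (\<Sum>i<n. (b i - b (Suc i)) *\<^sub>R e i) + b n *\<^sub>R e n"
proof (induction n)
  case 0 then show ?case by (simp add: difference_sequence_def)
next
  case (Suc n)
  have d: "d (Suc n) = e (Suc n) - e n" by (simp add: difference_sequence_def)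
  have "(\<Sum>i<Suc (Suc n). b i *\<^sub>R d i) = (\<Sum>i<Suc n. b i *\<^sub>R d i) + b (Suc n) *\<^sub>R d (Suc n)" by simp
  also have "\<dots> = (\<Sum>i<Suc n. (b i - b (Suc i)) *\<^sub>R e i) + b (Suc n) *\<^sub>R e (Suc n)"
    unfolding Suc d by (simp add: algebra_simps)
  finally show ?case .
qed

lemma norm_difference_sequence_ge: "1 \<le> norm (d i)"
proof (cases i)
  case 0 then show ?thesis by (simp add: difference_sequence_def)
next
  case (Suc k)
  then have "d i = e (Suc k) - e k" by (simp add: difference_sequence_def)
  then show ?thesis using abs_coord_le[of "d i" "Suc k"] by (simp add: coord_diff coord_basis)
qed

lemma tendsto_scaleR_basis_zero: "b \<longlonglongrightarrow> 0 \<Longrightarrow> (\<lambda>n. b n *\<^sub>R e n) \<longlonglongrightarrow> 0"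
  by (rule Lim_null_comparison[of _ "\<lambda>n. \<bar>b n\<bar>"]) (auto simp: tendsto_rabs_zero)

text \<open>The terms of a convergent series tend to 0 and the \<open>d i\<close> have norm at least
  1, so \<open>b\<close> is null. The boundary term of Abel summation then disappears and leaves the
  expansion in \<open>e\<close>.\<close>

lemma sums_difference_sequenceD:
  assumes "(\<lambda>i. b i *\<^sub>R d i) sums x"
  shows "b \<longlonglongrightarrow> 0" "coord e x i = b i - b (Suc i)"
proof -
  have "(\<lambda>i. b i *\<^sub>R d i) \<longlonglongrightarrow> 0" using assms sums_summable summable_LIMSEQ_zero by blast
  then have "(\<lambda>i. norm (b i *\<^sub>R d i)) \<longlonglongrightarrow> 0" by (rule tendsto_norm_zero)
  moreover have "norm (b i) \<le> norm (b i *\<^sub>R d i)" for i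
    using mult_left_mono[OF norm_difference_sequence_ge[of i], of "\<bar>b i\<bar>"] by simp
  ultimately show b: "b \<longlonglongrightarrow> 0"
    by (intro Lim_null_comparison[of b "\<lambda>i. norm (b i *\<^sub>R d i)"]) auto
  have "(\<lambda>n. (\<Sum>i<Suc n. b i *\<^sub>R d i) - b n *\<^sub>R e n) \<longlonglongrightarrow> x - 0"
    using assms unfolding sums_def by (intro tendsto_diff LIMSEQ_Suc tendsto_scaleR_basis_zero b)
  then have "(\<lambda>i. (b i - b (Suc i)) *\<^sub>R e i) sums x"
    unfolding sums_def sum_difference_sequence by simp
  from coord_eqI[OF basis this] show "coord e x i = b i - b (Suc i)" by simp
qed

lemma schauder_basis_difference_sequence: "schauder_basis d"
  unfolding schauder_basis_of_def
proof (intro conjI ballI)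
  fix x :: 'a
  \<comment> \<open>The tail of the coordinate series from \<open>i\<close> on: the only null
    sequence whose consecutive differences are the coordinates of \<open>x\<close>. Its existence
    rests on \<open>summable_coord\<close>.\<close>
  define b where "b i = (\<Sum>j. coord e x j) - (\<Sum>j<i. coord e x j)" for i
  have "(\<lambda>i. (\<Sum>j. coord e x j) - (\<Sum>j<i. coord e x j)) \<longlonglongrightarrow> (\<Sum>j. coord e x j) - (\<Sum>j. coord e x j)"
    by (intro tendsto_intros summable_LIMSEQ summable_coord)
  then have b0: "b \<longlonglongrightarrow> 0" by (simp add: b_def[abs_def])
  have "(\<lambda>n. (\<Sum>i<n. coord e x i *\<^sub>R e i) + b n *\<^sub>R e n) \<longlonglongrightarrow> x + 0"
    by (intro tendsto_add tendsto_partial_sums tendsto_scaleR_basis_zero b0)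
  moreover have "(\<Sum>i<Suc n. b i *\<^sub>R d i) = (\<Sum>i<n. coord e x i *\<^sub>R e i) + b n *\<^sub>R e n" for n
    unfolding sum_difference_sequence by (simp add: b_def)
  ultimately have "(\<lambda>n. \<Sum>i<Suc n. b i *\<^sub>R d i) \<longlonglongrightarrow> x" by simp
  then have ex: "(\<lambda>i. b i *\<^sub>R d i) sums x" unfolding sums_def by (rule LIMSEQ_imp_Suc)
  moreover have "c = b" if c: "(\<lambda>i. c i *\<^sub>R d i) sums x" for c
  proof
    fix i
    have "c j - c (Suc j) = b j - b (Suc j)" for j
      using sums_difference_sequenceD(2)[OF c, of j] sums_difference_sequenceD(2)[OF ex, of j] by simp
    then have step: "c (Suc j) - b (Suc j) = c j - b j" for j by (simp add: algebra_simps)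
    have const: "c j - b j = c 0 - b 0" for j by (induction j) (simp_all add: step)
    have "(\<lambda>j. c j - b j) \<longlonglongrightarrow> 0 - 0" by (intro tendsto_diff sums_difference_sequenceD(1)[OF c] b0)
    moreover have "(\<lambda>j. c j - b j) = (\<lambda>j. c 0 - b 0)" using const by blast
    ultimately have "(\<lambda>j::nat. c 0 - b 0) \<longlonglongrightarrow> 0" by simp
    then have "c 0 - b 0 = 0" by (simp add: LIMSEQ_const_iff)
    then show "c i = b i" using const[of i] by simp
  qed
  ultimately show "\<exists>!a. (\<lambda>i. a i *\<^sub>R d i) sums x" by blast
qed simp

text \<open>Coordinate \<open>k\<close> in \<open>e\<close> involves the coordinates
  \<open>k\<close> and \<open>Suc k\<close> in \<open>d\<close>, so the support may grow by one
  index to the left. The skipped index leaves room for this, and the blocks of \<open>d\<close> stay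
  disjoint as blocks of \<open>e\<close>.\<close>

theorem skipped_unconditional_basis_difference_sequence: "skipped_unconditional_basis d"
  unfolding skipped_unconditional_basis_def
proof (intro conjI allI impI schauder_basis_difference_sequence)
  fix x
  assume "Defs.normalized x \<and> block_basis d x \<and> (\<exists>i. strict_mono i \<and>
           (\<forall>j. (\<forall>k\<in>supp d (x j). k < i j) \<and> (\<forall>k\<in>supp d (x (Suc j)). i j < k)))"
  then obtain r where nx: "Defs.normalized x" and r: "strict_mono (r :: nat \<Rightarrow> nat)"
    and supp: "\<forall>j. (\<forall>k\<in>supp d (x j). k < r j) \<and> (\<forall>k\<in>supp d (x (Suc j)). r j < k)"
    by (elim conjE exE)
  have below: "k < r j" if "k \<in> supp d (x j)" for j k using supp that by blast
  have above: "r j < k" if "k \<in> supp d (x (Suc j))" for j k using supp that by blast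
  have nz: "x j \<noteq> 0" for j
  proof -
    have "norm (x j) = 1" using nx by (simp add: Defs.normalized_def)
    then show ?thesis by auto
  qed
  note sd = sums_coord[OF schauder_basis_difference_sequence]
  have cd: "coord d (x j) k = 0" if "r j \<le> k \<or> (\<exists>l. j = Suc l \<and> k \<le> r l)" for j k
    using that below[of k j] above[of k] by (fastforce simp: supp_def)
  have ce: "coord e (x j) k = coord d (x j) k - coord d (x j) (Suc k)" for j k
    by (rule sums_difference_sequenceD(2)[OF sd])
  \<comment> \<open>A later block has \<open>d\<close>-support strictly after the skipped index
    \<open>r l\<close>, so its \<open>e\<close>-support may start at \<open>r l\<close> itself,
    which is therefore the cut point.\<close>
  define q where "q j = (case j of 0 \<Rightarrow> 0 | Suc l \<Rightarrow> r l)" for j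
  \<comment> \<open>Needed for \<open>q 0 < q 1\<close>: otherwise the first block would have empty
    support and be zero.\<close>
  have "r 0 \<noteq> 0"
  proof
    assume "r 0 = 0"
    then have "coord d (x 0) k = 0" for k using cd[of 0 k] by simp
    then have "(\<lambda>i::nat. 0) sums x 0" using sd[of "x 0"] by simp
    then have "x 0 = 0" by (rule sums_unique2[OF _ sums_zero])
    then show False using nz by simp
  qed
  then have "strict_mono q" unfolding strict_mono_Suc_iff using r by (auto simp: q_def strict_mono_Suc_iff split: nat.split)
  moreover have "coord e (x j) k = 0" if k: "k \<notin> {q j..<q (Suc j)}" for j k
  proof (cases j)
    case 0
    then show ?thesis using k cd[of j k] cd[of j "Suc k"] by (auto simp: ce q_def)
  next
    case (Suc l)
    then consider "k < r l" | "r j \<le> k" using k by (auto simp: q_def)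
    then show ?thesis
      using Suc cd[of j k] cd[of j "Suc k"] by cases (auto simp: ce)
  qed
  ultimately have b: "blocks x q" by (simp add: blocks_def)
  have zero: "blinfun_apply sum_fun (x j) = 0" if "j \<noteq> 0" for j
  proof -
    obtain l where l: "j = Suc l" using \<open>j \<noteq> 0\<close> not0_implies_Suc by blast
    \<comment> \<open>The coordinate sum telescopes to the zeroth \<open>d\<close>-coordinate, which
      vanishes for every block but the first.\<close>
    have "(\<lambda>k. coord d (x j) k - coord d (x j) (Suc k)) sums (coord d (x j) 0 - 0)"
      by (rule telescope_sums'[OF sums_difference_sequenceD(1)[OF sd]])
    moreover have "coord d (x j) 0 = 0" using cd[of j 0] l by simp
    ultimately have "(\<lambda>k. coord e (x j) k) sums 0" by (simp add: ce)
    then show ?thesis by (simp add: sum_fun_apply summing_functional_def sums_iff)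
  qed
  show "unconditional_basic_sequence x"
    by (rule suppression_1_unconditional_imp_unconditional_basic_sequence[OF suppression_1_unconditional_blocks[OF b zero] nz])
qed

section \<open>The dual of the difference basis and the decomposition of the dual space\<close>

lemma biorthogonal_difference_sequence: "biorthogonal d i = sum_fun - (\<Sum>j<i. coord_fun j)"
  unfolding biorthogonal_def
proof (rule the_equality)
  have dS: "blinfun_apply sum_fun (d j) = (if j = 0 then 1 else 0)" for j
    by (simp add: difference_sequence_def blinfun.diff_right split: nat.split)
  have dc: "(\<Sum>l<i. coord e (d j) l) = (if j = 0 then (if i = 0 then 0 else 1) else if j = i then - 1 else 0)" for j
    by (cases j) (auto simp: difference_sequence_def coord_diff coord_basis sum_subtractf)
  show "\<forall>j. blinfun_apply (sum_fun - (\<Sum>j<i. coord_fun j)) (d j) = (if i = j then 1 else 0)"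
    by (auto simp: blinfun.diff_left blinfun.sum_left dS dc)
  fix f :: "'a \<Rightarrow>\<^sub>L real" assume f: "\<forall>j. blinfun_apply f (d j) = (if i = j then 1 else 0)"
  have e_eq: "e n = (\<Sum>j<Suc n. d j)" for n
    using sum_difference_sequence[of "\<lambda>_. 1" n] by simp
  show "f = sum_fun - (\<Sum>j<i. coord_fun j)"
  proof (rule blinfun_eq_if_basis_eq)
    fix n
    have "blinfun_apply f (e n) = blinfun_apply f (\<Sum>j<Suc n. d j)" by (rule arg_cong[OF e_eq])
    also have "\<dots> = (\<Sum>j<Suc n. if i = j then 1 else 0)"
      unfolding blinfun.sum_right using f by (intro sum.cong) auto
    finally have "blinfun_apply f (e n) = (if i \<le> n then 1 else 0)" by (simp add: less_Suc_eq_le)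
    then show "blinfun_apply f (e n) = blinfun_apply (sum_fun - (\<Sum>j<i. coord_fun j)) (e n)"
      by (simp add: blinfun.diff_left blinfun.sum_left coord_basis)
  qed
qed

text \<open>The zeroth biorthogonal functional is \<open>sum_fun\<close>, and consecutive ones
  differ by a coordinate functional. Shrinking thus becomes a statement about \<open>sum_fun\<close>
  and the coordinate functionals.\<close>

lemma span_biorthogonal_difference_sequence:
  "span (range (biorthogonal d)) = span (insert sum_fun (range coord_fun))"
proof (rule span_eq[THEN iffD2], intro conjI subsetI)
  fix f assume "f \<in> range (biorthogonal d)"
  then obtain i where f: "f = sum_fun - (\<Sum>j<i. coord_fun j)" by (auto simp: biorthogonal_difference_sequence)
  show "f \<in> span (insert sum_fun (range coord_fun))"
    unfolding f by (intro span_diff span_sum span_base) auto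
next
  have mem: "biorthogonal d i \<in> span (range (biorthogonal d))" for i by (simp add: span_base)
  fix f assume "f \<in> insert sum_fun (range coord_fun)"
  then consider "f = sum_fun" | i where "f = coord_fun i" by blast
  then show "f \<in> span (range (biorthogonal d))"
  proof cases
    case 1
    then show ?thesis using mem[of 0] by (simp add: biorthogonal_difference_sequence)
  next
    case (2 i)
    have "f = biorthogonal d i - biorthogonal d (Suc i)" by (simp add: 2 biorthogonal_difference_sequence)
    then show ?thesis using mem by (simp add: span_diff)
  qed
qed

lemma shrinking_iff: "shrinking d \<longleftrightarrow> closed_span (insert sum_fun (range coord_fun)) = UNIV"
  by (simp add: shrinking_def closed_span_def span_biorthogonal_difference_sequence)

lemma closed_span_coord_fun_tendsto_zero:
  assumes "f \<in> closed_span (range coord_fun)"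
  shows "(\<lambda>n. blinfun_apply f (e n)) \<longlonglongrightarrow> 0"
proof (rule blinfun_tendsto_zero_closed_span[where B = 1, OF _ _ assms])
  fix h assume "h \<in> range coord_fun"
  then obtain i where i: "h = coord_fun i" by blast
  have "\<forall>\<^sub>F n in sequentially. blinfun_apply h (e n) = 0"
    unfolding eventually_sequentially by (intro exI[of _ "Suc i"]) (auto simp: i coord_basis)
  then show "(\<lambda>n. blinfun_apply h (e n)) \<longlonglongrightarrow> 0" by (simp add: tendsto_eventually)
qed simp

text \<open>Functionals in the closed span of the coordinates tend to 0 along the basis, whereas
  \<open>sum_fun\<close> is 1 there. The separating \<open>G\<close> serves as a projection in the
  dual and later spans the extra dimension of the bidual.\<close>

lemma sum_fun_separation:
  "\<exists>G :: ('a \<Rightarrow>\<^sub>L real) \<Rightarrow>\<^sub>L real.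
     (\<forall>f\<in>closed_span (range coord_fun). blinfun_apply G f = 0) \<and> blinfun_apply G sum_fun = 1"
proof -
  have "sum_fun \<notin> closed_span (range coord_fun)"
  proof
    assume "sum_fun \<in> closed_span (range coord_fun)"
    from closed_span_coord_fun_tendsto_zero[OF this] show False by (simp add: LIMSEQ_const_iff)
  qed
  then show ?thesis by (rule separating_functional[OF subspace_closed_span closed_closed_span])
qed

lemma coord_fun_in_closed_span: "coord_fun i \<in> closed_span (range coord_fun)"
  using span_subset_closed_span[of "range coord_fun"] span_base[of "coord_fun i" "range coord_fun"] by auto

text \<open>The point is that adding the line through \<open>sum_fun\<close> to the closed span of
  the coordinates gives a space that is already closed. The functional \<open>G\<close> reads off
  the coefficient of \<open>sum_fun\<close>.\<close>

lemma direct_sum_iff: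
  "direct_sum_decomposition (span {sum_fun}) (closed_span (range coord_fun)) \<longleftrightarrow>
     closed_span (insert sum_fun (range coord_fun)) = UNIV"
  (is "?L \<longleftrightarrow> ?R")
proof -
  let ?V = "closed_span (range coord_fun)"
  obtain G :: "('a \<Rightarrow>\<^sub>L real) \<Rightarrow>\<^sub>L real"
    where GV: "\<And>f. f \<in> ?V \<Longrightarrow> blinfun_apply G f = 0" and GS: "blinfun_apply G sum_fun = 1"
    using sum_fun_separation by blast
  have V0: "0 \<in> ?V" by (rule subspace_0[OF subspace_closed_span])
  show ?thesis
  proof
    assume ?L
    have "f \<in> closed_span (insert sum_fun (range coord_fun))" for f
    proof -
      have "f \<in> {u + v | u v. u \<in> span {sum_fun} \<and> v \<in> ?V}"
        using \<open>?L\<close> by (simp add: direct_sum_decomposition_def)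
      then obtain u v where f: "f = u + v" "u \<in> span {sum_fun}" "v \<in> ?V" by blast
      have "u \<in> closed_span (insert sum_fun (range coord_fun))"
        using f(2) span_subset_closed_span span_mono[of "{sum_fun}" "insert sum_fun (range coord_fun)"] by blast
      moreover have "v \<in> closed_span (insert sum_fun (range coord_fun))"
        using f(3) closure_mono[OF span_mono[OF subset_insertI]] unfolding closed_span_def by blast
      ultimately show ?thesis unfolding f(1) by (rule subspace_add[OF subspace_closed_span])
    qed
    then show ?R by blast
  next
    assume ?R
    \<comment> \<open>The sum of the two subspaces, written as the preimage of a closed space under
      a continuous map, which makes it visibly closed.\<close>
    define W where "W = {f. f - blinfun_apply G f *\<^sub>R sum_fun \<in> ?V}"
    have "closed W"
    proof -
      have "W = (\<lambda>f. f - blinfun_apply G f *\<^sub>R sum_fun) -` ?V" by (auto simp: W_def)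
      then show ?thesis by (simp only:) (intro closed_vimage closed_closed_span continuous_intros)
    qed
    moreover have "subspace W"
    proof (rule subspaceI)
      show "0 \<in> W" using V0 by (simp add: W_def)
    next
      fix f g assume "f \<in> W" "g \<in> W"
      then have "(f - blinfun_apply G f *\<^sub>R sum_fun) + (g - blinfun_apply G g *\<^sub>R sum_fun) \<in> ?V"
        unfolding W_def using subspace_add[OF subspace_closed_span] by blast
      then show "f + g \<in> W" by (simp add: W_def blinfun.add_right algebra_simps)
    next
      fix c f assume "f \<in> W"
      then have "c *\<^sub>R (f - blinfun_apply G f *\<^sub>R sum_fun) \<in> ?V"
        unfolding W_def using subspace_scale[OF subspace_closed_span] by blast
      then show "c *\<^sub>R f \<in> W" by (simp add: W_def blinfun.scaleR_right algebra_simps)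
    qed
    moreover have "insert sum_fun (range coord_fun) \<subseteq> W"
      using GV[OF coord_fun_in_closed_span] coord_fun_in_closed_span V0 by (auto simp: W_def GS)
    ultimately have W: "f \<in> W" for f using \<open>?R\<close> closed_span_minimal by blast
    have "\<exists>u v. f = u + v \<and> u \<in> span {sum_fun} \<and> v \<in> ?V" for f
      using W[of f] by (intro exI[of _ "blinfun_apply G f *\<^sub>R sum_fun"] exI[of _ "f - blinfun_apply G f *\<^sub>R sum_fun"])
        (simp add: W_def span_base span_scale)
    moreover have "f = 0" if "f \<in> span {sum_fun}" "f \<in> ?V" for f
      using that GV[of f] GS by (auto simp: span_singleton blinfun.scaleR_right)
    ultimately show ?L
      unfolding direct_sum_decomposition_def using V0 span_zero[of "{sum_fun}"] by blast
  qed
qed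

end

subsection \<open>Bounded completeness and \<open>c\<^sub>0\<close>\<close>

text \<open>The intervals between consecutive values of \<open>p\<close> partition the naturals
  because \<open>p 0 = 0\<close>; \<open>k\<close> numbers the interval of each index. Being
  monotone, it yields strictly increasing shifts of the form \<open>i + p (k i)\<close>.\<close>

lemma strict_mono_block_index:
  fixes p :: "nat \<Rightarrow> nat"
  assumes p: "strict_mono p" "p 0 = 0"
  obtains k where "mono k" "\<And>i j. p j \<le> i \<and> i < p (Suc j) \<longleftrightarrow> k i = j"
proof -
  define k where "k i = (LEAST j. i < p (Suc j))" for i
  have ex: "i < p (Suc i)" for i using strict_mono_imp_increasing[OF p(1), of "Suc i"] by simp
  have up: "i < p (Suc (k i))" for i unfolding k_def by (rule LeastI[of _ i]) (rule ex)
  have low: "p (k i) \<le> i" for i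
  proof (cases "k i")
    case 0 then show ?thesis using p(2) by simp
  next
    case (Suc l)
    then have "\<not> i < p (Suc l)" using not_less_Least[of l "\<lambda>j. i < p (Suc j)"] by (simp add: k_def)
    then show ?thesis using Suc by simp
  qed
  have "mono k"
  proof (rule monoI)
    fix i i' :: nat assume "i \<le> i'"
    then have "i < p (Suc (k i'))" using up[of i'] by simp
    then show "k i \<le> k i'" unfolding k_def[of i] by (rule Least_le)
  qed
  moreover have "p j \<le> i \<and> i < p (Suc j) \<longleftrightarrow> k i = j" for i j
  proof
    assume h: "p j \<le> i \<and> i < p (Suc j)"
    then have "p j < p (Suc (k i))" "p (k i) < p (Suc j)"
      using up[of i] low[of i] by (meson le_less_trans less_le_trans)+
    then have "j < Suc (k i)" "k i < Suc j" using strict_mono_less[OF p(1)] by blast+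
    then show "k i = j" by simp
  qed (use up low in auto)
  ultimately show ?thesis using that by blast
qed

lemma sum_lessThan_blocks:
  fixes f :: "nat \<Rightarrow> 'b::comm_monoid_add"
  assumes p: "strict_mono (p :: nat \<Rightarrow> nat)" "p 0 = 0"
  shows "(\<Sum>i<p n. f i) = (\<Sum>k<n. \<Sum>i\<in>{p k..<p (Suc k)}. f i)"
proof (induction n)
  case (Suc n)
  have "p n \<le> p (Suc n)" using p(1) by (simp add: strict_mono_less_eq)
  then have "(\<Sum>i<p (Suc n). f i) = (\<Sum>i<p n. f i) + (\<Sum>i\<in>{p n..<p (Suc n)}. f i)"
    using sum.atLeastLessThan_concat[of 0 "p n" "p (Suc n)" f] by (simp add: atLeast0LessThan)
  then show ?case using Suc by simp
qed (simp add: p)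

context spreading_basis begin

text \<open>Each block of a bounded divergent series is placed twice, with opposite signs, on consecutive
  intervals. The two copies together have coefficient sum zero, and the partial sums of either family
  of copies are spreads of those of the original series.\<close>

lemma zero_sum_blocks_if_not_boundedly_complete:
  assumes "\<not> boundedly_complete e"
  obtains w q \<delta> M where "blocks w q" "\<And>k. blinfun_apply sum_fun (w k) = 0" "\<delta> > 0"
    "\<And>k. \<delta> \<le> norm (w k)" "\<And>n. norm (\<Sum>k<n. w k) \<le> M"
proof -
  obtain a where a: "bounded (range (\<lambda>n. \<Sum>i<n. a i *\<^sub>R e i))" "\<not> summable (\<lambda>i. a i *\<^sub>R e i)"
    using assms unfolding boundedly_complete_def by blast
  obtain M where M: "\<And>n. norm (\<Sum>i<n. a i *\<^sub>R e i) \<le> M" using a(1) unfolding bounded_iff by blast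
  obtain \<delta> where \<delta>: "\<delta> > 0" "\<And>N. \<exists>m\<ge>N. \<exists>n. \<delta> \<le> norm (\<Sum>i\<in>{m..<n}. a i *\<^sub>R e i)"
    using a(2) unfolding summable_Cauchy by (auto simp: not_less)
  \<comment> \<open>Failure of the Cauchy criterion gives large segments only somewhere beyond
    \<open>N\<close>; by bimonotonicity such a segment may be extended to the left to start at
    \<open>N\<close> itself.\<close>
  have "\<exists>n>N. \<delta> \<le> norm (\<Sum>i\<in>{N..<n}. a i *\<^sub>R e i)" for N
  proof -
    obtain m n where mn: "m \<ge> N" "\<delta> \<le> norm (\<Sum>i\<in>{m..<n}. a i *\<^sub>R e i)" using \<delta>(2) by blast
    have "m < n" using mn(2) \<delta>(1) by (cases "m < n") auto
    moreover have "\<delta> \<le> norm (\<Sum>i\<in>{N..<n}. a i *\<^sub>R e i)"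
      by (rule order_trans[OF mn(2) norm_sum_atLeastLessThan_le_sum]) (use mn in auto)
    ultimately show ?thesis using mn(1) by (intro exI[of _ n]) simp
  qed
  then obtain nxt where nxt: "\<And>N. nxt N > N" "\<And>N. \<delta> \<le> norm (\<Sum>i\<in>{N..<nxt N}. a i *\<^sub>R e i)" by metis
  define p where "p k = (nxt ^^ k) 0" for k
  have p: "strict_mono p" "p 0 = 0" using nxt(1) by (simp_all add: p_def strict_mono_Suc_iff)
  have big: "\<delta> \<le> norm (\<Sum>i\<in>{p j..<p (Suc j)}. a i *\<^sub>R e i)" for j using nxt(2) by (simp add: p_def)
  obtain k where k: "mono k" "\<And>i j. p j \<le> i \<and> i < p (Suc j) \<longleftrightarrow> k i = j"
    using strict_mono_block_index[OF p] by metis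
  \<comment> \<open>Block \<open>j\<close> is shifted by \<open>p j\<close> into
    \<open>{2 * p j..<p j + p (Suc j)}\<close> and by \<open>p (Suc j)\<close> into
    \<open>{p j + p (Suc j)..<2 * p (Suc j)}\<close>. The two copies together fill
    \<open>{q j..<q (Suc j)}\<close> with \<open>q j = 2 * p j\<close>.\<close>
  define A where "A i = i + p (k i)" for i
  define B where "B i = i + p (Suc (k i))" for i
  have AB: "strict_mono A" "strict_mono B"
    using k(1) p(1) by (auto simp: A_def B_def strict_mono_def monoD strict_mono_less_eq intro!: add_less_le_mono)
  define u where "u j = (\<Sum>i\<in>{p j..<p (Suc j)}. a i *\<^sub>R e (A i))" for j
  define v where "v j = (\<Sum>i\<in>{p j..<p (Suc j)}. a i *\<^sub>R e (B i))" for j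
  define w where "w j = u j - v j" for j
  define q where "q j = 2 * p j" for j
  have cu: "coord e (u j) l = 0" if "l \<notin> {2 * p j..<p j + p (Suc j)}" for j l
  proof -
    have "l \<noteq> A i" if "i \<in> {p j..<p (Suc j)}" for i
      using that \<open>l \<notin> _\<close> k(2)[of j i] by (auto simp: A_def)
    then show ?thesis unfolding u_def coord_sum by (intro sum.neutral ballI) (simp add: coord_scaleR[OF basis] coord_basis)
  qed
  have cv: "coord e (v j) l = 0" if "l \<notin> {p j + p (Suc j)..<2 * p (Suc j)}" for j l
  proof -
    have "l \<noteq> B i" if "i \<in> {p j..<p (Suc j)}" for i
      using that \<open>l \<notin> _\<close> k(2)[of j i] by (auto simp: B_def)
    then show ?thesis unfolding v_def coord_sum by (intro sum.neutral ballI) (simp add: coord_scaleR[OF basis] coord_basis)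
  qed
  have less: "p j < p (Suc j)" for j using p(1) by (simp add: strict_mono_Suc_iff)
  have "blocks w q"
    unfolding blocks_def
  proof (intro conjI allI impI)
    show "strict_mono q" using p(1) by (simp add: q_def strict_mono_def)
    fix j i assume "i \<notin> {q j..<q (Suc j)}"
    then show "coord e (w j) i = 0"
      using cu[of i j] cv[of i j] less[of j] by (auto simp: w_def coord_diff q_def)
  qed
  moreover have "blinfun_apply sum_fun (w j) = 0" for j
    by (simp add: w_def u_def v_def blinfun.diff_right blinfun.sum_right blinfun.scaleR_right)
  moreover have "\<delta> \<le> norm (w j)" for j
  proof -
    have "\<delta> \<le> norm (u j)" using big norm_spread[OF _ AB(1), of "{p j..<p (Suc j)}" a] by (simp add: u_def)
    \<comment> \<open>The first copy is an initial segment of \<open>w j\<close>, so its norm bounds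
      that of \<open>w j\<close> from below.\<close>
    also have "u j = (\<Sum>l<p j + p (Suc j). coord e (u j) l *\<^sub>R e l)"
      by (rule sum_coord_eq[OF basis, symmetric]) (use cu[of _ j] in auto)
    also have "\<dots> = (\<Sum>l<p j + p (Suc j). coord e (w j) l *\<^sub>R e l)"
      using cv[of _ j] by (intro sum.cong) (auto simp: w_def coord_diff)
    also have "norm \<dots> \<le> norm (w j)" by (rule norm_sum_lessThan_le)
    finally show ?thesis .
  qed
  moreover have "norm (\<Sum>j<n. w j) \<le> 2 * M" for n
  proof -
    have "(\<Sum>j<n. w j) = (\<Sum>i<p n. a i *\<^sub>R e (A i)) - (\<Sum>i<p n. a i *\<^sub>R e (B i))"
      by (simp add: w_def u_def v_def sum_subtractf sum_lessThan_blocks[OF p])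
    also have "norm \<dots> \<le> norm (\<Sum>i<p n. a i *\<^sub>R e (A i)) + norm (\<Sum>i<p n. a i *\<^sub>R e (B i))"
      by (rule norm_triangle_ineq4)
    also have "\<dots> = norm (\<Sum>i<p n. a i *\<^sub>R e i) + norm (\<Sum>i<p n. a i *\<^sub>R e i)"
      by (simp add: norm_spread AB)
    finally show ?thesis using M[of "p n"] by simp
  qed
  ultimately show ?thesis using that \<delta>(1) by blast
qed

lemma c0_embeds_if_not_boundedly_complete:
  assumes "\<not> boundedly_complete e"
  shows "c0_embeds TYPE('a)"
proof -
  obtain w q \<delta> M where w: "blocks w q" "\<And>k. blinfun_apply sum_fun (w k) = 0" "\<delta> > 0"
    "\<And>k. \<delta> \<le> norm (w k)" "\<And>n. norm (\<Sum>k<n. w k) \<le> M"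
    using zero_sum_blocks_if_not_boundedly_complete[OF assms] by metis
  show ?thesis
    by (rule c0_embeds_if_bounded_partial_sums[OF suppression_1_unconditional_blocks[OF w(1) w(2)] w(5) w(3) w(4)])
qed

section \<open>Gliding humps and the exclusion of c_0\<close>

text \<open>For a late vector the finitely many coordinates before \<open>p0\<close> are negligible,
  and for that vector the coordinates beyond some \<open>p1\<close> are too. Using \<open>p1\<close>
  as the next starting point makes the intervals adjacent.\<close>

lemma gliding_hump:
  assumes x: "\<And>i. (\<lambda>n. coord e (x n) i) \<longlonglongrightarrow> 0" and \<epsilon>: "\<And>k. \<epsilon> k > 0"
  obtains r p where "strict_mono r" "strict_mono p" "p 0 = 0"
    "\<And>k. norm (x (r k) - (\<Sum>i\<in>{p k..<p (Suc k)}. coord e (x (r k)) i *\<^sub>R e i)) < \<epsilon> k"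
proof -
  let ?good = "\<lambda>k r p0 p1. norm (x r - (\<Sum>i\<in>{p0..<p1}. coord e (x r) i *\<^sub>R e i)) < \<epsilon> k"
  have step: "\<exists>r p1. r0 < r \<and> p0 < p1 \<and> ?good k r p0 p1" for k r0 p0
  proof -
    have "(\<lambda>n. \<Sum>i<p0. coord e (x n) i *\<^sub>R e i) \<longlonglongrightarrow> (\<Sum>i<p0. 0 *\<^sub>R e i)"
      by (intro tendsto_intros x)
    then obtain N where N: "\<And>n. n \<ge> N \<Longrightarrow> norm (\<Sum>i<p0. coord e (x n) i *\<^sub>R e i) < \<epsilon> k / 2"
      using LIMSEQ_D[of _ 0 "\<epsilon> k / 2"] \<epsilon>[of k] by auto
    define r where "r = max N (Suc r0)"
    obtain P where P: "\<And>n. n \<ge> P \<Longrightarrow> norm ((\<Sum>i<n. coord e (x r) i *\<^sub>R e i) - x r) < \<epsilon> k / 2"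
      using LIMSEQ_D[OF tendsto_partial_sums[of "x r"], of "\<epsilon> k / 2"] \<epsilon>[of k] by auto
    define p1 where "p1 = max P (Suc p0)"
    have "(\<Sum>i<p1. coord e (x r) i *\<^sub>R e i) = (\<Sum>i<p0. coord e (x r) i *\<^sub>R e i) + (\<Sum>i\<in>{p0..<p1}. coord e (x r) i *\<^sub>R e i)"
      using sum.atLeastLessThan_concat[of 0 p0 p1 "\<lambda>i. coord e (x r) i *\<^sub>R e i"] by (simp add: atLeast0LessThan p1_def)
    then have "x r - (\<Sum>i\<in>{p0..<p1}. coord e (x r) i *\<^sub>R e i)
        = (\<Sum>i<p0. coord e (x r) i *\<^sub>R e i) - ((\<Sum>i<p1. coord e (x r) i *\<^sub>R e i) - x r)" by simp
    also have "norm \<dots> \<le> norm (\<Sum>i<p0. coord e (x r) i *\<^sub>R e i) + norm ((\<Sum>i<p1. coord e (x r) i *\<^sub>R e i) - x r)"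
      by (rule norm_triangle_ineq4)
    also have "\<dots> < \<epsilon> k" using N[of r] P[of p1] by (simp add: r_def p1_def)
    finally have "?good k r p0 p1" .
    moreover have "r0 < r" "p0 < p1" by (auto simp: r_def p1_def)
    ultimately show ?thesis by blast
  qed
  \<comment> \<open>A state holds the chosen index and both ends of its interval; the clause for
    \<open>n = 0\<close> pins the first interval to start at 0.\<close>
  let ?P = "\<lambda>n (r, p0, p1). (n = 0 \<longrightarrow> p0 = 0) \<and> p0 < p1 \<and> ?good n r p0 p1"
  let ?Q = "\<lambda>n (r, p0, p1) (r', p0', p1'). r < r' \<and> p0' = p1"
  have "\<exists>f. \<forall>n. ?P n (f n) \<and> ?Q n (f n) (f (Suc n))"
  proof (rule dependent_nat_choice)
    show "\<exists>s. ?P 0 s" using step[of 0 0 0] by auto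
  next
    fix s n assume "?P n s"
    obtain r p0 p1 where s: "s = (r, p0, p1)" by (cases s)
    obtain r' p1' where "r < r'" "p1 < p1'" "?good (Suc n) r' p1 p1'" using step[of r p1 "Suc n"] by blast
    then show "\<exists>t. ?P (Suc n) t \<and> ?Q n s t" unfolding s by (intro exI[of _ "(r', p1, p1')"]) simp
  qed
  then obtain f where f: "\<forall>n. ?P n (f n) \<and> ?Q n (f n) (f (Suc n))" by (rule exE)
  define r where "r n = fst (f n)" for n
  define p where "p n = fst (snd (f n))" for n
  have f': "p 0 = 0" "p n < snd (snd (f n))" "?good n (r n) (p n) (snd (snd (f n)))"
    "r n < r (Suc n)" "p (Suc n) = snd (snd (f n))" for n
    using f[THEN spec, of 0] f[THEN spec, of n] by (simp_all add: case_prod_beta p_def r_def)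
  have "strict_mono r" "strict_mono p" using f'(2,4,5) by (simp_all add: strict_mono_Suc_iff)
  moreover have "norm (x (r k) - (\<Sum>i\<in>{p k..<p (Suc k)}. coord e (x (r k)) i *\<^sub>R e i)) < \<epsilon> k" for k
    using f'(3)[of k] unfolding f'(5) .
  moreover note f'(1)
  ultimately show ?thesis using that by blast
qed

text \<open>The images of the unit vectors of c_0 have null coordinates, so a subsequence is nearly
  a block sequence. Gluing these blocks gives a series with bounded partial sums whose blocks stay
  away from 0, against bounded completeness.\<close>

lemma not_c0_embeds_if_boundedly_complete:
  assumes bc: "boundedly_complete e"
  shows "\<not> c0_embeds TYPE('a)"
proof
  let ?V = "{a :: nat \<Rightarrow> real. a \<longlonglongrightarrow> 0}" and ?N = "\<lambda>a :: nat \<Rightarrow> real. SUP i. \<bar>a i\<bar>"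
  assume "c0_embeds TYPE('a)"
  then obtain T :: "(nat \<Rightarrow> real) \<Rightarrow> 'a" where emb: "isomorphic_embedding ?V ?N T"
    unfolding c0_embeds_def by (rule exE)
  have Tadd: "T (\<lambda>i. a i + b i) = T a + T b" if "a \<in> ?V" "b \<in> ?V" for a b
    using emb that unfolding isomorphic_embedding_def by (elim conjE) simp
  have Tscale: "T (\<lambda>i. c * a i) = c *\<^sub>R T a" if "a \<in> ?V" for c a
    using emb that unfolding isomorphic_embedding_def by (elim conjE) simp
  obtain m M where m: "m > 0" and TN: "\<forall>a\<in>?V. m * ?N a \<le> norm (T a) \<and> norm (T a) \<le> M * ?N a"
    using emb unfolding isomorphic_embedding_def by (elim conjE exE)
  have T: "m * ?N a \<le> norm (T a)" "norm (T a) \<le> M * ?N a" if "a \<in> ?V" for a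
    using bspec[OF TN that] by auto
  define \<delta> :: "nat \<Rightarrow> nat \<Rightarrow> real" where "\<delta> n = (\<lambda>i. if i = n then 1 else 0)" for n
  define x where "x n = T (\<delta> n)" for n
  define I :: "nat set \<Rightarrow> (nat \<Rightarrow> real) \<Rightarrow> nat \<Rightarrow> real" where "I A c = (\<lambda>i. if i \<in> A then c i else 0)" for A c
  have IV: "I A c \<in> ?V" if A: "finite A" for A c
  proof -
    obtain N where "A \<subseteq> {..<N}" using A finite_nat_iff_bounded by blast
    then have "\<forall>\<^sub>F i in sequentially. I A c i = 0"
      unfolding eventually_sequentially I_def by (intro exI[of _ N]) auto
    then show ?thesis by (simp add: tendsto_eventually)
  qed
  have \<delta>I: "\<delta> n = I {n} (\<lambda>_. 1)" for n by (auto simp: \<delta>_def I_def)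
  have \<delta>V: "\<delta> n \<in> ?V" for n unfolding \<delta>I by (rule IV) simp
  have TI: "T (I A c) = (\<Sum>n\<in>A. c n *\<^sub>R x n)" if "finite A" for A c
    using that
  proof (induction A)
    case empty
    have "T (\<lambda>i. 0 * \<delta> 0 i) = 0 *\<^sub>R T (\<delta> 0)" by (rule Tscale[OF \<delta>V])
    then show ?case by (simp add: I_def)
  next
    case (insert n A)
    have c\<delta>: "(\<lambda>i. c n * \<delta> n i) \<in> ?V"
      using IV[of "{n}" c] by (rule back_subst[of "\<lambda>f. f \<in> ?V"]) (auto simp: I_def \<delta>_def)
    have "I (insert n A) c = (\<lambda>i. c n * \<delta> n i + I A c i)" using insert(2) by (auto simp: I_def \<delta>_def)
    then have "T (I (insert n A) c) = c n *\<^sub>R x n + T (I A c)"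
      using Tadd[OF c\<delta> IV[OF insert(1)]] Tscale[OF \<delta>V[of n], of "c n"] by (simp add: x_def)
    then show ?case using insert by simp
  qed
  have N\<delta>: "?N (\<delta> n) = 1" for n
    by (rule antisym[OF cSUP_least cSUP_upper2[of _ _ n]]) (auto simp: \<delta>_def bdd_above_def intro!: exI[of _ 1])
  have mx: "m \<le> norm (x n)" for n using T(1)[OF \<delta>V[of n]] by (simp add: N\<delta> x_def)
  have M0: "0 \<le> M" using mx[of 0] m T(2)[OF \<delta>V[of 0]] by (simp add: N\<delta> x_def)
  have bound: "norm (\<Sum>n\<in>A. c n *\<^sub>R x n) \<le> M" if A: "finite A" and c: "\<And>n. \<bar>c n\<bar> \<le> 1" for A c
  proof -
    have "?N (I A c) \<le> 1" using c by (intro cSUP_least) (auto simp: I_def)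
    then have "M * ?N (I A c) \<le> M * 1" using M0 by (rule mult_left_mono)
    then show ?thesis using T(2)[OF IV[OF A], of c] TI[OF A, of c] by simp
  qed
  have null: "(\<lambda>n. coord e (x n) i) \<longlonglongrightarrow> 0" for i
  proof -
    have "(\<Sum>n<k. \<bar>coord e (x n) i\<bar>) \<le> M" for k
    proof -
      \<comment> \<open>Choosing signs turns the absolute sum into one coordinate of a combination
        with coefficients of modulus at most 1, which \<open>bound\<close> controls.\<close>
      have "(\<Sum>n<k. \<bar>coord e (x n) i\<bar>) = (\<Sum>n<k. sgn (coord e (x n) i) * coord e (x n) i)"
        by (intro sum.cong) (auto simp: abs_sgn mult.commute)
      also have "\<dots> = coord e (\<Sum>n<k. sgn (coord e (x n) i) *\<^sub>R x n) i"
        by (simp add: coord_sum coord_scaleR[OF basis])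
      also have "\<dots> \<le> norm (\<Sum>n<k. sgn (coord e (x n) i) *\<^sub>R x n)"
        using abs_coord_le abs_le_D1 by blast
      also have "\<dots> \<le> M" by (rule bound) (auto simp: sgn_if)
      finally show ?thesis .
    qed
    then have "summable (\<lambda>n. \<bar>coord e (x n) i\<bar>)" by (intro summableI_nonneg_bounded[of _ M]) auto
    then show ?thesis using summable_LIMSEQ_zero tendsto_rabs_zero_iff by blast
  qed
  \<comment> \<open>The errors add up to at most \<open>m / 4\<close>. At the end a norm of at least
    \<open>m\<close> is compared with \<open>m / 2 + m / 4\<close>.\<close>
  define \<epsilon> where "\<epsilon> k = m / 4 * (1 / 2) ^ Suc k" for k
  have \<epsilon>pos: "\<epsilon> k > 0" for k using m by (simp add: \<epsilon>_def)
  have \<epsilon>sum: "(\<Sum>k<n. \<epsilon> k) = m / 4 * (1 - (1 / 2) ^ n)" for n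
    by (induction n) (simp_all add: \<epsilon>_def algebra_simps)
  have \<epsilon>le: "\<epsilon> k \<le> m / 4" for k using m power_le_one[of "1/2::real" "Suc k"] by (simp add: \<epsilon>_def del: power_Suc)
  obtain r p where r: "strict_mono r" and p: "strict_mono p" "p 0 = 0"
    and close: "\<And>k. norm (x (r k) - (\<Sum>i\<in>{p k..<p (Suc k)}. coord e (x (r k)) i *\<^sub>R e i)) < \<epsilon> k"
    using gliding_hump[of x \<epsilon>, OF null \<epsilon>pos] by metis
  obtain \<kappa> where \<kappa>: "\<And>i j. p j \<le> i \<and> i < p (Suc j) \<longleftrightarrow> \<kappa> i = j"
    using strict_mono_block_index[OF p] by metis
  define a where "a i = coord e (x (r (\<kappa> i))) i" for i
  define u where "u k = (\<Sum>i\<in>{p k..<p (Suc k)}. a i *\<^sub>R e i)" for k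
  have uk: "u k = (\<Sum>i\<in>{p k..<p (Suc k)}. coord e (x (r k)) i *\<^sub>R e i)" for k
    unfolding u_def by (intro sum.cong) (use \<kappa> in \<open>auto simp: a_def\<close>)
  have xu: "norm (x (r k) - u k) < \<epsilon> k" for k unfolding uk by (rule close)
  have "norm (\<Sum>i<n. a i *\<^sub>R e i) \<le> M + m / 4" for n
  proof -
    \<comment> \<open>An arbitrary initial segment is enlarged to a whole number of blocks, at no
      loss by bimonotonicity.\<close>
    have "n \<le> p n" by (rule strict_mono_imp_increasing[OF p(1)])
    then have "norm (\<Sum>i<n. a i *\<^sub>R e i) \<le> norm (\<Sum>i<p n. a i *\<^sub>R e i)"
      using norm_sum_atLeastLessThan_le_sum[of "{..<p n}" 0 n a] by (simp add: atLeast0LessThan)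
    also have "(\<Sum>i<p n. a i *\<^sub>R e i) = (\<Sum>k<n. u k)" by (simp add: sum_lessThan_blocks[OF p] u_def)
    also have "\<dots> = (\<Sum>k<n. x (r k)) - (\<Sum>k<n. x (r k) - u k)" by (simp add: sum_subtractf)
    also have "norm \<dots> \<le> norm (\<Sum>k<n. x (r k)) + norm (\<Sum>k<n. x (r k) - u k)" by (rule norm_triangle_ineq4)
    also have "norm (\<Sum>k<n. x (r k) - u k) \<le> (\<Sum>k<n. \<epsilon> k)"
      by (rule order_trans[OF norm_sum]) (intro sum_mono less_imp_le xu)
    also have "(\<Sum>k<n. \<epsilon> k) \<le> m / 4" unfolding \<epsilon>sum using m by (simp add: mult_left_le)
    also have "norm (\<Sum>k<n. x (r k)) \<le> M"
    proof -
      have "(\<Sum>k<n. x (r k)) = (\<Sum>j\<in>r ` {..<n}. 1 *\<^sub>R x j)"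
        using r by (simp add: sum.reindex strict_mono_imp_inj_on inj_on_def strict_mono_eq)
      then show ?thesis using bound[of "r ` {..<n}" "\<lambda>_. 1"] by simp
    qed
    finally show ?thesis by simp
  qed
  then have "summable (\<lambda>i. a i *\<^sub>R e i)"
    using bc unfolding boundedly_complete_def bounded_iff by blast
  then obtain N where N: "\<And>k n. k \<ge> N \<Longrightarrow> norm (\<Sum>i\<in>{k..<n}. a i *\<^sub>R e i) < m / 2"
    unfolding summable_Cauchy using m by (meson half_gt_zero)
  have "norm (u N) < m / 2" unfolding u_def by (rule N) (rule strict_mono_imp_increasing[OF p(1)])
  moreover have "norm (x (r N)) \<le> norm (u N) + norm (x (r N) - u N)"
    using norm_triangle_ineq[of "u N" "x (r N) - u N"] by simp
  ultimately show False using mx[of "r N"] xu[of N] \<epsilon>le[of N] m by simp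
qed

theorem boundedly_complete_iff: "boundedly_complete e \<longleftrightarrow> \<not> c0_embeds TYPE('a)"
  using c0_embeds_if_not_boundedly_complete not_c0_embeds_if_boundedly_complete by blast

end

subsection \<open>Functionals, \<open>\<ell>\<^sub>1\<close> and the bidual\<close>

lemma diagonal_convergent_subsequence:
  fixes a :: "nat \<Rightarrow> nat \<Rightarrow> real"
  assumes "\<And>i. bounded (range (a i))"
  obtains r where "strict_mono r" "\<And>i. convergent (\<lambda>n. a i (r n))"
proof -
  interpret subseqs "\<lambda>i s. convergent (a i \<circ> s)"
  proof
    fix i and s :: "nat \<Rightarrow> nat"
    have "bounded (range (a i \<circ> s))" by (rule bounded_subset[OF assms[of i]]) auto
    then obtain l r where "strict_mono (r :: nat \<Rightarrow> nat)" "((a i \<circ> s) \<circ> r) \<longlonglongrightarrow> l"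
      using bounded_imp_convergent_subsequence by metis
    then show "\<exists>r. strict_mono r \<and> convergent (a i \<circ> (s \<circ> r))"
      by (intro exI[of _ r]) (simp add: convergentI o_assoc)
  qed
  have "convergent (\<lambda>n. a i (diagseq n))" for i
  proof -
    have "convergent (a i \<circ> (diagseq \<circ> ((+) (Suc i))))"
    proof (rule diagseq_holds)
      fix r s n assume "strict_mono (r :: nat \<Rightarrow> nat)" "convergent (a n \<circ> s)"
      then show "convergent (a n \<circ> (s \<circ> r))"
        using convergent_subseq_convergent[of "a n \<circ> s" r] by (simp add: o_assoc)
    qed
    then have "convergent (\<lambda>n. a i (diagseq (n + Suc i)))" by (simp add: o_def add.commute)
    then show ?thesis using convergent_ignore_initial_segment[of "\<lambda>n. a i (diagseq n)" "Suc i"] by simp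
  qed
  then show ?thesis using that[OF subseq_diagseq] by blast
qed

lemma blinfun_eq_zero_on_closed_span:
  fixes F :: "'a::real_normed_vector \<Rightarrow>\<^sub>L real"
  assumes "\<And>x. x \<in> A \<Longrightarrow> blinfun_apply F x = 0" "y \<in> closed_span A"
  shows "blinfun_apply F y = 0"
proof -
  have "closed_span A \<subseteq> {x. blinfun_apply F x = 0}"
  proof (rule closed_span_minimal)
    show "closed {x. blinfun_apply F x = 0}" by (intro closed_Collect_eq continuous_intros)
    show "subspace {x. blinfun_apply F x = 0}"
      by (auto simp: subspace_def blinfun.add_right blinfun.scaleR_right)
  qed (use assms(1) in auto)
  then show ?thesis using assms(2) by blast
qed

lemma canonical_embedding_apply [simp]: "blinfun_apply (canonical_embedding x) f = blinfun_apply f x"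
  unfolding canonical_embedding_def
  by (simp add: bounded_linear_Blinfun_apply blinfun.bounded_linear_left)

text \<open>The quotient of the bidual by X is one-dimensional, so any two elements of the bidual
  are linearly dependent modulo X.\<close>

lemma quasi_reflexive_imp_dependent:
  fixes \<Phi> \<Psi> :: "('b::real_normed_vector \<Rightarrow>\<^sub>L real) \<Rightarrow>\<^sub>L real"
  assumes "quasi_reflexive_of_order 1 TYPE('b)"
  shows "\<exists>\<alpha> \<beta> x. (\<alpha> \<noteq> 0 \<or> \<beta> \<noteq> 0) \<and> \<alpha> *\<^sub>R \<Phi> + \<beta> *\<^sub>R \<Psi> = canonical_embedding x"
proof -
  let ?J = "canonical_embedding :: 'b \<Rightarrow> ('b \<Rightarrow>\<^sub>L real) \<Rightarrow>\<^sub>L real"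
  obtain B where B: "card B = 1" "direct_sum_decomposition (span B) (range ?J)"
    using assms unfolding quasi_reflexive_of_order_def has_codimension_def by blast
  obtain b where b: "B = {b}" using B(1) card_1_singletonE by blast
  have ex: "\<exists>c x. F = c *\<^sub>R b + ?J x" for F
  proof -
    have "F \<in> {u + v | u v. u \<in> span {b} \<and> v \<in> range ?J}"
      using B(2) by (simp add: direct_sum_decomposition_def b)
    then show ?thesis by (auto simp: span_singleton)
  qed
  obtain c x where c: "\<Phi> = c *\<^sub>R b + ?J x" using ex by blast
  obtain c' x' where c': "\<Psi> = c' *\<^sub>R b + ?J x'" using ex by blast
  show ?thesis
  proof (cases "c = 0")
    case True
    then show ?thesis using c by (intro exI[of _ 1] exI[of _ 0] exI[of _ x]) simp
  next
    case False
    have "c' *\<^sub>R \<Phi> + (- c) *\<^sub>R \<Psi> = ?J (c' *\<^sub>R x - c *\<^sub>R x')"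
      unfolding c c'
      by (rule blinfun_eqI) (simp add: blinfun.add_left blinfun.diff_left blinfun.scaleR_left blinfun.diff_right blinfun.scaleR_right blinfun.minus_left algebra_simps)
    then show ?thesis using False neg_equal_0_iff_equal by blast
  qed
qed

context spreading_basis begin

text \<open>With \<open>\<delta>\<close> the distance from \<open>f\<close> to the closed span,
  beyond each \<open>m\<close> there is a finitely supported zero-sum vector of controlled norm on
  which \<open>f\<close> is at least \<open>\<delta> / 2\<close>. Successive such vectors form
  blocks on which \<open>f\<close> is bounded below.\<close>

lemma l1_embeds_if_not_in_closed_span:
  assumes f: "f \<notin> closed_span (insert sum_fun (range coord_fun))"
  shows "l1_embeds TYPE('a)"
proof -
  let ?V = "closed_span (insert sum_fun (range coord_fun))"
  define \<delta> where "\<delta> = infdist f ?V"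
  have "?V \<noteq> {}" using subspace_0[OF subspace_closed_span] by blast
  then have \<delta>: "\<delta> > 0"
    using f in_closed_iff_infdist_zero[OF closed_closed_span] infdist_nonneg[of f ?V] by (fastforce simp: \<delta>_def less_le)
  have "\<exists>N v. m < N \<and> (\<forall>i. i \<notin> {m..<N} \<longrightarrow> coord e v i = 0) \<and> blinfun_apply sum_fun v = 0 \<and>
      norm v \<le> 1 + norm sum_fun \<and> \<delta> / 2 \<le> blinfun_apply f v" for m
  proof -
    \<comment> \<open>\<open>h\<close> agrees with \<open>f\<close> on \<open>e i\<close> for
      \<open>i < m\<close> and is constantly \<open>blinfun_apply f (e m)\<close> on later basis
      vectors. So \<open>f - h\<close> kills the former and takes the value of \<open>f\<close> at
      \<open>e i - e m\<close> on the latter.\<close>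
    define h where "h = (\<Sum>i<m. blinfun_apply f (e i) *\<^sub>R coord_fun i) + blinfun_apply f (e m) *\<^sub>R (sum_fun - (\<Sum>i<m. coord_fun i))"
    have "h \<in> span (insert sum_fun (range coord_fun))"
      unfolding h_def by (intro span_add span_sum span_scale span_diff span_base) auto
    then have "h \<in> ?V" using span_subset_closed_span by blast
    then have "\<delta> \<le> norm (f - h)" using infdist_le[of h ?V f] by (simp add: \<delta>_def dist_norm)
    then have "\<not> norm (f - h) \<le> \<delta> / 2" using \<delta> by simp
    then have "\<not> (\<forall>z. norm (blinfun_apply (f - h) z) \<le> \<delta> / 2 * norm z)"
      using norm_blinfun_bound[of "\<delta> / 2" "f - h"] \<delta> by auto
    then obtain z where z: "\<delta> / 2 * norm z < \<bar>blinfun_apply (f - h) z\<bar>" by (auto simp: not_le)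
    then have z0: "norm z > 0" by (cases "z = 0") auto
    define x where "x = (sgn (blinfun_apply (f - h) z) / norm z) *\<^sub>R z"
    have "0 < \<bar>blinfun_apply (f - h) z\<bar>" by (rule order_le_less_trans[OF _ z]) (use \<delta> in simp)
    then have "\<bar>sgn (blinfun_apply (f - h) z)\<bar> = 1" by (simp add: abs_sgn_eq)
    then have nx: "norm x = 1" using z0 by (simp add: x_def)
    have "blinfun_apply (f - h) x = \<bar>blinfun_apply (f - h) z\<bar> / norm z"
      by (simp only: x_def blinfun.scaleR_right) (simp add: abs_sgn mult.commute)
    then have fx: "\<delta> / 2 < blinfun_apply (f - h) x" using z z0 by (simp add: pos_less_divide_eq)
    let ?c = "coord e x"
    \<comment> \<open>Truncation to \<open>{m..<N}\<close>, corrected at \<open>e m\<close> to have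
      coefficient sum zero. By the choice of \<open>h\<close>, the values of \<open>f\<close> at
      \<open>v N\<close> tend to that of \<open>f - h\<close> at \<open>x\<close>. The correction
      costs at most \<open>norm sum_fun\<close>.\<close>
    define v where "v N = (\<Sum>i\<in>{m..<N}. ?c i *\<^sub>R e i) - (\<Sum>i\<in>{m..<N}. ?c i) *\<^sub>R e m" for N
    have ivl: "(\<Sum>i\<in>{m..<N}. g i) = (\<Sum>i<N. g i) - (\<Sum>i<m. g i)" if "m \<le> N" for N and g :: "nat \<Rightarrow> real"
      using sum.atLeastLessThan_concat[of 0 m N g] that by (simp add: atLeast0LessThan)
    have fv: "blinfun_apply f (v N) = ((\<Sum>i<N. ?c i * blinfun_apply f (e i)) - (\<Sum>i<m. ?c i * blinfun_apply f (e i)))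
        - ((\<Sum>i<N. ?c i) - (\<Sum>i<m. ?c i)) * blinfun_apply f (e m)" if "m \<le> N" for N
      by (simp add: v_def blinfun.diff_right blinfun.sum_right blinfun.scaleR_right ivl[OF that])
    have "(\<lambda>i. blinfun_apply f (?c i *\<^sub>R e i)) sums blinfun_apply f x"
      by (rule bounded_linear.sums[OF blinfun.bounded_linear_right sums_coord[OF basis]])
    then have "(\<lambda>N. \<Sum>i<N. ?c i * blinfun_apply f (e i)) \<longlonglongrightarrow> blinfun_apply f x"
      by (simp add: sums_def blinfun.scaleR_right)
    moreover have "(\<lambda>N. \<Sum>i<N. ?c i) \<longlonglongrightarrow> blinfun_apply sum_fun x"
      using summable_LIMSEQ[OF summable_coord] by (simp add: sum_fun_apply summing_functional_def)
    ultimately have "(\<lambda>N. ((\<Sum>i<N. ?c i * blinfun_apply f (e i)) - (\<Sum>i<m. ?c i * blinfun_apply f (e i)))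
        - ((\<Sum>i<N. ?c i) - (\<Sum>i<m. ?c i)) * blinfun_apply f (e m)) \<longlonglongrightarrow>
        (blinfun_apply f x - (\<Sum>i<m. ?c i * blinfun_apply f (e i))) - (blinfun_apply sum_fun x - (\<Sum>i<m. ?c i)) * blinfun_apply f (e m)"
      by (intro tendsto_intros)
    also have "(blinfun_apply f x - (\<Sum>i<m. ?c i * blinfun_apply f (e i))) - (blinfun_apply sum_fun x - (\<Sum>i<m. ?c i)) * blinfun_apply f (e m)
        = blinfun_apply (f - h) x"
      by (simp add: h_def blinfun.diff_left blinfun.add_left blinfun.sum_left blinfun.scaleR_left algebra_simps)
    finally have lim: "(\<lambda>N. ((\<Sum>i<N. ?c i * blinfun_apply f (e i)) - (\<Sum>i<m. ?c i * blinfun_apply f (e i)))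
        - ((\<Sum>i<N. ?c i) - (\<Sum>i<m. ?c i)) * blinfun_apply f (e m)) \<longlonglongrightarrow> blinfun_apply (f - h) x" .
    have "\<forall>\<^sub>F N in sequentially. m < N \<and> \<delta> / 2 < ((\<Sum>i<N. ?c i * blinfun_apply f (e i)) - (\<Sum>i<m. ?c i * blinfun_apply f (e i)))
        - ((\<Sum>i<N. ?c i) - (\<Sum>i<m. ?c i)) * blinfun_apply f (e m)"
      using order_tendstoD(1)[OF lim fx] eventually_gt_at_top[of m] by eventually_elim simp
    then obtain N where N: "m < N" "\<delta> / 2 < blinfun_apply f (v N)"
      using fv eventually_happens'[OF sequentially_bot] by (metis (no_types, lifting) less_imp_le_nat)
    have "coord e (v N) i = 0" if "i \<notin> {m..<N}" for i
      using that N(1) by (auto simp: v_def coord_diff coord_scaleR[OF basis] coord_sum_scaleR[OF basis] coord_basis)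
    moreover have "blinfun_apply sum_fun (v N) = 0"
      by (simp add: v_def blinfun.diff_right sum_fun_sum blinfun.scaleR_right)
    moreover have "norm (v N) \<le> 1 + norm sum_fun"
    proof -
      let ?u = "\<Sum>i\<in>{m..<N}. ?c i *\<^sub>R e i"
      have u: "norm ?u \<le> 1" using norm_sum_atLeastLessThan_le[of x m N] nx by simp
      have "\<bar>\<Sum>i\<in>{m..<N}. ?c i\<bar> \<le> norm sum_fun * norm ?u"
        using norm_blinfun[of sum_fun ?u] by (simp add: sum_fun_sum)
      also have "\<dots> \<le> norm sum_fun" using u by (simp add: mult_left_le)
      finally show ?thesis
        using norm_triangle_ineq4[of ?u "(\<Sum>i\<in>{m..<N}. ?c i) *\<^sub>R e m"] u by (simp add: v_def)
    qed
    ultimately show ?thesis using N by (intro exI[of _ N] exI[of _ "v N"]) simp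
  qed
  then obtain nxt v where nv: "\<And>m. m < nxt m" "\<And>m i. i \<notin> {m..<nxt m} \<Longrightarrow> coord e (v m) i = 0"
    "\<And>m. blinfun_apply sum_fun (v m) = 0" "\<And>m. norm (v m) \<le> 1 + norm sum_fun" "\<And>m. \<delta> / 2 \<le> blinfun_apply f (v m)"
    by metis
  define q where "q k = (nxt ^^ k) 0" for k
  have "blocks (\<lambda>k. v (q k)) q"
    unfolding blocks_def using nv(1,2) by (simp add: q_def strict_mono_Suc_iff)
  then have "suppression_1_unconditional (\<lambda>k. v (q k))"
    by (rule suppression_1_unconditional_blocks) (rule nv(3))
  then show ?thesis
    by (rule l1_embeds_if_functional_bounded_below[where \<delta> = "\<delta> / 2"]) (use nv(4,5) \<delta> in auto)
qed

text \<open>A diagonal subsequence of the images of the unit vectors converges on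
  \<open>sum_fun\<close> and on all coordinates, so differences of neighbouring terms are weakly
  null. But l_1 carries a bounded functional equal to 1 on all these differences, and Hahn-Banach
  extends it.\<close>

lemma not_l1_embeds_if_closed_span_eq_UNIV:
  assumes UNIV: "closed_span (insert sum_fun (range coord_fun)) = UNIV"
  shows "\<not> l1_embeds TYPE('a)"
proof
  let ?V = "{a :: nat \<Rightarrow> real. summable (\<lambda>i. \<bar>a i\<bar>)}" and ?N = "\<lambda>a :: nat \<Rightarrow> real. \<Sum>i. \<bar>a i\<bar>"
  assume "l1_embeds TYPE('a)"
  then obtain T :: "(nat \<Rightarrow> real) \<Rightarrow> 'a" where emb: "isomorphic_embedding ?V ?N T"
    unfolding l1_embeds_def by (rule exE)
  have Tadd: "T (\<lambda>i. a i + b i) = T a + T b" if "a \<in> ?V" "b \<in> ?V" for a b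
    using emb that unfolding isomorphic_embedding_def by (elim conjE) simp
  have Tscale: "T (\<lambda>i. c * a i) = c *\<^sub>R T a" if "a \<in> ?V" for c a
    using emb that unfolding isomorphic_embedding_def by (elim conjE) simp
  obtain m M where m: "m > 0" and TN: "\<forall>a\<in>?V. m * ?N a \<le> norm (T a) \<and> norm (T a) \<le> M * ?N a"
    using emb unfolding isomorphic_embedding_def by (elim conjE exE)
  have T: "m * ?N a \<le> norm (T a)" "norm (T a) \<le> M * ?N a" if "a \<in> ?V" for a
    using bspec[OF TN that] by auto
  define \<delta> :: "nat \<Rightarrow> nat \<Rightarrow> real" where "\<delta> n = (\<lambda>i. if i = n then 1 else 0)" for n
  have \<delta>sums: "(\<lambda>i. \<bar>\<delta> n i\<bar>) sums 1" for n
    using sums_single[of n "\<lambda>_. 1::real"] by (simp add: \<delta>_def if_distrib[of abs] cong: if_cong)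
  have \<delta>V: "\<delta> n \<in> ?V" for n using \<delta>sums sums_summable by auto
  define x where "x n = T (\<delta> n)" for n
  have nx: "norm (x n) \<le> M" for n
    using T(2)[OF \<delta>V[of n]] sums_unique[OF \<delta>sums[of n]] by (simp add: x_def)
  define h where "h i = (case i of 0 \<Rightarrow> sum_fun | Suc j \<Rightarrow> coord_fun j)" for i
  have "bounded (range (\<lambda>n. blinfun_apply (h i) (x n)))" for i
    unfolding bounded_iff
  proof (intro exI[of _ "norm (h i) * M"] ballI, elim imageE, simp only:)
    fix n
    show "norm (blinfun_apply (h i) (x n)) \<le> norm (h i) * M"
      by (rule order_trans[OF norm_blinfun]) (simp add: mult_left_mono nx)
  qed
  then obtain r where r: "strict_mono r" "\<And>i. convergent (\<lambda>n. blinfun_apply (h i) (x (r n)))"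
    using diagonal_convergent_subsequence[of "\<lambda>i n. blinfun_apply (h i) (x n)"] by metis
  define y where "y k = x (r (2 * k)) - x (r (Suc (2 * k)))" for k
  have hy: "(\<lambda>k. blinfun_apply (h i) (y k)) \<longlonglongrightarrow> 0" for i
  proof -
    obtain l where l: "(\<lambda>n. blinfun_apply (h i) (x (r n))) \<longlonglongrightarrow> l" using r(2) convergent_def by blast
    have "(\<lambda>k. blinfun_apply (h i) (x (r (2 * k)))) \<longlonglongrightarrow> l"
      using LIMSEQ_subseq_LIMSEQ[OF l, of "\<lambda>k. 2 * k"] by (simp add: strict_mono_def o_def)
    moreover have "(\<lambda>k. blinfun_apply (h i) (x (r (Suc (2 * k))))) \<longlonglongrightarrow> l"
      using LIMSEQ_subseq_LIMSEQ[OF l, of "\<lambda>k. Suc (2 * k)"] by (simp add: strict_mono_def o_def)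
    ultimately have "(\<lambda>k. blinfun_apply (h i) (x (r (2 * k))) - blinfun_apply (h i) (x (r (Suc (2 * k))))) \<longlonglongrightarrow> l - l"
      by (rule tendsto_diff)
    then show ?thesis by (simp add: y_def blinfun.diff_right)
  qed
  have null: "(\<lambda>k. blinfun_apply f (y k)) \<longlonglongrightarrow> 0" for f :: "'a \<Rightarrow>\<^sub>L real"
  proof (rule blinfun_tendsto_zero_closed_span[where B = "2 * M" and H = "insert sum_fun (range coord_fun)"])
    show "norm (y k) \<le> 2 * M" for k
      using norm_triangle_ineq4[of "x (r (2 * k))" "x (r (Suc (2 * k)))"] nx[of "r (2 * k)"] nx[of "r (Suc (2 * k))"]
      by (simp add: y_def)
    show "f \<in> closed_span (insert sum_fun (range coord_fun))" using UNIV by simp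
    fix g assume "g \<in> insert sum_fun (range coord_fun)"
    then consider "g = h 0" | j where "g = h (Suc j)" by (auto simp: h_def)
    then show "(\<lambda>k. blinfun_apply g (y k)) \<longlonglongrightarrow> 0" using hy by cases auto
  qed
  \<comment> \<open>The indices at even places of the subsequence: the indicator of \<open>A\<close>
    is 1 on the first and 0 on the second term of each difference.\<close>
  define A where "A = range (\<lambda>k. r (2 * k))"
  define \<phi> where "\<phi> a = (\<Sum>i. indicator A i * a i)" for a :: "nat \<Rightarrow> real"
  have summ: "summable (\<lambda>i. indicator A i * a i)" if "a \<in> ?V" for a :: "nat \<Rightarrow> real"
    by (rule summable_comparison_test'[of "\<lambda>i. \<bar>a i\<bar>" 0]) (use that in \<open>auto simp: indicator_def\<close>)
  have \<phi>le: "\<phi> a \<le> ?N a" if "a \<in> ?V" for a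
    unfolding \<phi>_def by (rule suminf_le) (use summ[OF that] that in \<open>auto simp: indicator_def\<close>)
  \<comment> \<open>The graph of \<open>\<phi>\<close> transported to the image of \<open>T\<close>.
    The lower estimate of the embedding gives the bound \<open>inverse m\<close>.\<close>
  let ?F = "{(T a, \<phi> a) | a. a \<in> ?V}"
  have F: "subspace ?F"
  proof (rule subspaceI)
    have z: "(\<lambda>_. 0) \<in> ?V" by simp
    have "T (\<lambda>_. 0) = 0" using Tscale[OF z, of 0] by simp
    then show "0 \<in> ?F" using z by (auto simp: zero_prod_def \<phi>_def intro!: exI[of _ "\<lambda>_. 0"])
  next
    fix s t assume "s \<in> ?F" "t \<in> ?F"
    then obtain a b where ab: "a \<in> ?V" "b \<in> ?V" "s = (T a, \<phi> a)" "t = (T b, \<phi> b)" by blast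
    have "summable (\<lambda>i. \<bar>a i + b i\<bar>)"
      by (rule summable_comparison_test'[of "\<lambda>i. \<bar>a i\<bar> + \<bar>b i\<bar>" 0]) (use ab(1,2) in \<open>auto intro: summable_add abs_triangle_ineq\<close>)
    moreover have "\<phi> (\<lambda>i. a i + b i) = \<phi> a + \<phi> b"
      using summ[OF ab(1)] summ[OF ab(2)] by (simp add: \<phi>_def distrib_left suminf_add)
    ultimately show "s + t \<in> ?F"
      using Tadd[OF ab(1,2)] ab by (auto intro!: exI[of _ "\<lambda>i. a i + b i"])
  next
    fix c t assume "t \<in> ?F"
    then obtain a where a: "a \<in> ?V" "t = (T a, \<phi> a)" by blast
    have "summable (\<lambda>i. \<bar>c * a i\<bar>)" using a(1) by (simp add: abs_mult)
    moreover have "\<phi> (\<lambda>i. c * a i) = c * \<phi> a"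
      using suminf_mult[OF summ[OF a(1)], of c] by (simp add: \<phi>_def mult.left_commute)
    ultimately show "c *\<^sub>R t \<in> ?F"
      using Tscale[OF a(1)] a by (auto intro!: exI[of _ "\<lambda>i. c * a i"])
  qed
  have Fb: "t \<le> inverse m * norm z" if "(z, t) \<in> ?F" for z t
  proof -
    obtain a where a: "a \<in> ?V" "z = T a" "t = \<phi> a" using \<open>(z, t) \<in> ?F\<close> by blast
    have "m * t \<le> m * ?N a" unfolding a(3) by (rule mult_left_mono[OF \<phi>le[OF a(1)] less_imp_le[OF m]])
    also have "\<dots> \<le> norm z" unfolding a(2) by (rule T(1)[OF a(1)])
    finally have "m * t \<le> norm z" .
    then show ?thesis using m by (simp add: field_simps)
  qed
  have "\<exists>g :: 'a \<Rightarrow>\<^sub>L real. \<forall>z t. (z, t) \<in> ?F \<longrightarrow> blinfun_apply g z = t"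
  proof (rule hahn_banach_graph)
    show "subspace ?F" by (rule F)
    show "t \<le> inverse m * norm z" if "(z, t) \<in> ?F" for z t by (rule Fb[OF that])
    show "0 \<le> inverse m" using m by simp
    fix g :: "'a \<Rightarrow>\<^sub>L real" assume "\<And>z t. (z, t) \<in> ?F \<Longrightarrow> blinfun_apply g z = t"
    then show "\<exists>g :: 'a \<Rightarrow>\<^sub>L real. \<forall>z t. (z, t) \<in> ?F \<longrightarrow> blinfun_apply g z = t" by (intro exI[of _ g]) simp
  qed
  then obtain g :: "'a \<Rightarrow>\<^sub>L real" where g: "\<forall>z t. (z, t) \<in> ?F \<longrightarrow> blinfun_apply g z = t"
    by (rule exE)
  have gx: "blinfun_apply g (x n) = indicator A n" for n
  proof -
    have "\<phi> (\<delta> n) = (\<Sum>i\<in>{n}. indicator A i * \<delta> n i)"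
      unfolding \<phi>_def by (rule suminf_finite) (auto simp: \<delta>_def)
    then have "\<phi> (\<delta> n) = indicator A n" by (simp add: \<delta>_def)
    moreover have mem: "(x n, \<phi> (\<delta> n)) \<in> ?F" using \<delta>V[of n] unfolding x_def by blast
    have "blinfun_apply g (x n) = \<phi> (\<delta> n)" by (rule mp[OF spec[OF spec[OF g]] mem])
    ultimately show ?thesis by simp
  qed
  have "r (Suc (2 * k)) \<notin> A" for k
  proof
    assume "r (Suc (2 * k)) \<in> A"
    then obtain j where "r (Suc (2 * k)) = r (2 * j)" by (auto simp: A_def)
    then have "Suc (2 * k) = 2 * j" using strict_mono_eq[OF r(1)] by blast
    then show False by presburger
  qed
  then have "blinfun_apply g (y k) = 1" for k by (simp add: y_def blinfun.diff_right gx A_def)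
  then show False using null[of g] by (simp add: LIMSEQ_const_iff)
qed

theorem shrinking_difference_sequence_iff: "shrinking d \<longleftrightarrow> \<not> l1_embeds TYPE('a)"
  unfolding shrinking_iff using l1_embeds_if_not_in_closed_span not_l1_embeds_if_closed_span_eq_UNIV by blast

section \<open>Quasi-reflexivity\<close>

text \<open>The values of \<open>\<Phi>\<close> on the coordinate functionals are the coefficients
  of a series with bounded partial sums, whose sum \<open>x\<close> exists by bounded completeness.
  Then \<open>\<Phi>\<close> and the image of \<open>x\<close> can differ only on
  \<open>sum_fun\<close>, and a multiple of \<open>G\<close> repairs that.\<close>

lemma quasi_reflexive_if:
  assumes bc: "boundedly_complete e" and UNIV: "closed_span (insert sum_fun (range coord_fun)) = UNIV"
  shows "quasi_reflexive_of_order 1 TYPE('a)"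
proof -
  let ?J = "canonical_embedding :: 'a \<Rightarrow> ('a \<Rightarrow>\<^sub>L real) \<Rightarrow>\<^sub>L real"
  obtain G :: "('a \<Rightarrow>\<^sub>L real) \<Rightarrow>\<^sub>L real"
    where GV: "\<forall>f\<in>closed_span (range coord_fun). blinfun_apply G f = 0" and GS: "blinfun_apply G sum_fun = 1"
    using sum_fun_separation by (elim exE conjE)
  have Gc: "blinfun_apply G (coord_fun i) = 0" for i by (rule bspec[OF GV coord_fun_in_closed_span])
  have J0: "?J 0 = 0" by (rule blinfun_eqI) simp
  have "F = 0" if F: "F \<in> span {G}" "F \<in> range ?J" for F
  proof -
    obtain c where c: "F = c *\<^sub>R G" using F(1) by (auto simp: span_singleton)
    obtain x where x: "F = ?J x" using F(2) by blast
    have "coord e x i = 0" for i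
    proof -
      have "coord e x i = blinfun_apply (?J x) (coord_fun i)" by simp
      also have "\<dots> = 0" unfolding x[symmetric] c by (simp add: blinfun.scaleR_left Gc)
      finally show ?thesis .
    qed
    then have "x = 0" by (intro eq_if_coord_eq) simp
    then show ?thesis using x J0 by simp
  qed
  moreover have "\<exists>s x. \<Phi> = s *\<^sub>R G + ?J x" for \<Phi>
  proof -
    define a where "a i = blinfun_apply \<Phi> (coord_fun i)" for i
    have "norm (\<Sum>i<n. a i *\<^sub>R e i) \<le> norm \<Phi>" for n
    proof -
      let ?x = "\<Sum>i<n. a i *\<^sub>R e i"
      obtain f :: "'a \<Rightarrow>\<^sub>L real" where f: "norm f \<le> 1" "blinfun_apply f ?x = norm ?x"
        by (rule norming_functional)
      \<comment> \<open>This is \<open>f\<close> composed with the projection onto the first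
        \<open>n\<close> coordinates, so its norm is at most 1, and \<open>\<Phi>\<close> takes on
        it the value of \<open>f\<close> at \<open>?x\<close>.\<close>
      let ?g = "\<Sum>i<n. blinfun_apply f (e i) *\<^sub>R coord_fun i"
      have "norm ?g \<le> 1"
      proof (rule norm_blinfun_bound)
        fix z
        have "blinfun_apply ?g z = blinfun_apply f (\<Sum>i<n. coord e z i *\<^sub>R e i)"
          by (simp add: blinfun.sum_left blinfun.scaleR_left blinfun.sum_right blinfun.scaleR_right mult.commute)
        then have "norm (blinfun_apply ?g z) \<le> norm f * norm (\<Sum>i<n. coord e z i *\<^sub>R e i)"
          using norm_blinfun by metis
        also have "\<dots> \<le> 1 * norm z" by (intro mult_mono f norm_sum_lessThan_le) auto
        finally show "norm (blinfun_apply ?g z) \<le> 1 * norm z" .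
      qed simp
      have "norm ?x = blinfun_apply \<Phi> ?g"
        using f(2) by (simp add: a_def blinfun.sum_right blinfun.scaleR_right mult.commute)
      also have "\<dots> \<le> norm \<Phi> * norm ?g" using norm_blinfun[of \<Phi> ?g] by simp
      also have "\<dots> \<le> norm \<Phi>" using \<open>norm ?g \<le> 1\<close> by (simp add: mult_left_le)
      finally show ?thesis .
    qed
    then have "summable (\<lambda>i. a i *\<^sub>R e i)"
      using bc unfolding boundedly_complete_def bounded_iff by blast
    then have "coord e (\<Sum>i. a i *\<^sub>R e i) = a" by (intro coord_eqI[OF basis] summable_sums)
    then obtain x where x: "\<And>i. coord e x i = a i" by metis
    define s where "s = blinfun_apply \<Phi> sum_fun - blinfun_apply sum_fun x"
    define \<Psi> where "\<Psi> = \<Phi> - ?J x - s *\<^sub>R G"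
    have "blinfun_apply \<Psi> g = 0" if "g \<in> insert sum_fun (range coord_fun)" for g
      using that by (auto simp: \<Psi>_def s_def blinfun.diff_left blinfun.scaleR_left GS Gc x a_def)
    then have "blinfun_apply \<Psi> g = 0" for g
      by (rule blinfun_eq_zero_on_closed_span[where A = "insert sum_fun (range coord_fun)"]) (auto simp: UNIV)
    then have "\<Psi> = 0" by (intro blinfun_eqI) simp
    then have "\<Phi> = s *\<^sub>R G + ?J x" by (simp add: \<Psi>_def algebra_simps)
    then show ?thesis by blast
  qed
  moreover have "0 \<in> range ?J" using J0 by (metis rangeI)
  ultimately have int: "span {G} \<inter> range ?J = {0}"
    and dec: "\<And>\<Phi>. \<exists>s x. \<Phi> = s *\<^sub>R G + ?J x"
    using span_zero[of "{G}"] by auto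
  have "{u + v | u v. u \<in> span {G} \<and> v \<in> range ?J} = UNIV"
  proof (rule UNIV_eq_I[symmetric])
    fix \<Phi>
    obtain s x where "\<Phi> = s *\<^sub>R G + ?J x" using dec by blast
    then show "\<Phi> \<in> {u + v | u v. u \<in> span {G} \<and> v \<in> range ?J}"
      by (intro CollectI exI[of _ "s *\<^sub>R G"] exI[of _ "?J x"]) (simp add: span_base span_scale)
  qed
  then have "direct_sum_decomposition (span {G}) (range ?J)"
    unfolding direct_sum_decomposition_def using int by (intro conjI)
  moreover have "independent {G}" using GS by (auto simp: dependent_single)
  ultimately show ?thesis
    unfolding quasi_reflexive_of_order_def has_codimension_def by (intro exI[of _ "{G}"]) simp
qed

text \<open>A functional \<open>\<Phi>\<close> separating some \<open>f\<close> from the closed span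
  would be independent of \<open>G\<close> modulo X: testing a dependence on the coordinates gives
  \<open>x = 0\<close>, on \<open>sum_fun\<close> gives \<open>\<beta> = 0\<close>, and on
  \<open>f\<close> gives \<open>\<alpha> = 0\<close>.\<close>

lemma closed_span_eq_UNIV_if_quasi_reflexive:
  assumes "quasi_reflexive_of_order 1 TYPE('a)"
  shows "closed_span (insert sum_fun (range coord_fun)) = UNIV"
proof (rule ccontr)
  assume "\<not> ?thesis"
  then obtain f where f: "f \<notin> closed_span (insert sum_fun (range coord_fun))" by blast
  obtain \<Phi> :: "('a \<Rightarrow>\<^sub>L real) \<Rightarrow>\<^sub>L real"
    where \<Phi>: "\<forall>g\<in>closed_span (insert sum_fun (range coord_fun)). blinfun_apply \<Phi> g = 0" "blinfun_apply \<Phi> f = 1"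
    using separating_functional[OF subspace_closed_span closed_closed_span f] by (elim exE conjE)
  have \<Phi>0: "blinfun_apply \<Phi> g = 0" if "g \<in> insert sum_fun (range coord_fun)" for g
    by (rule bspec[OF \<Phi>(1) subsetD[OF span_subset_closed_span span_base[OF that]]])
  obtain G :: "('a \<Rightarrow>\<^sub>L real) \<Rightarrow>\<^sub>L real"
    where GV: "\<forall>f\<in>closed_span (range coord_fun). blinfun_apply G f = 0" and GS: "blinfun_apply G sum_fun = 1"
    using sum_fun_separation by (elim exE conjE)
  obtain \<alpha> \<beta> x where ab: "\<alpha> \<noteq> 0 \<or> \<beta> \<noteq> 0" "\<alpha> *\<^sub>R \<Phi> + \<beta> *\<^sub>R G = canonical_embedding x"
    using quasi_reflexive_imp_dependent[OF assms, of \<Phi> G] by (elim exE conjE)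
  have app: "\<alpha> * blinfun_apply \<Phi> g + \<beta> * blinfun_apply G g = blinfun_apply g x" for g
    using arg_cong[OF ab(2), of "\<lambda>F. blinfun_apply F g"] by (simp add: blinfun.add_left blinfun.scaleR_left)
  have "coord e x i = 0" for i
    using app[of "coord_fun i"] \<Phi>0[of "coord_fun i"] bspec[OF GV coord_fun_in_closed_span[of i]] by simp
  then have "x = 0" by (intro eq_if_coord_eq) simp
  then have "\<beta> = 0" using app[of sum_fun] \<Phi>0[of sum_fun] GS by simp
  then show False using app[of f] \<Phi>(2) \<open>x = 0\<close> ab(1) by simp
qed

text \<open>If bounded completeness fails, the formal sum of the zero-sum blocks \<open>w k\<close>
  acts on the dual as a bidual element \<open>\<Phi>\<close> that is independent of \<open>G\<close>
  modulo X.\<close>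

lemma boundedly_complete_if_quasi_reflexive:
  assumes "quasi_reflexive_of_order 1 TYPE('a)"
  shows "boundedly_complete e"
proof (rule ccontr)
  assume nbc: "\<not> boundedly_complete e"
  obtain w q \<delta> M where w: "blocks w q" "\<And>k. blinfun_apply sum_fun (w k) = 0" "\<delta> > 0"
    "\<And>k. \<delta> \<le> norm (w k)" "\<And>n. norm (\<Sum>k<n. w k) \<le> M"
    using zero_sum_blocks_if_not_boundedly_complete[OF nbc] by metis
  have s: "suppression_1_unconditional w" by (rule suppression_1_unconditional_blocks[OF w(1) w(2)])
  have bd: "(\<Sum>k<n. \<bar>blinfun_apply f (w k)\<bar>) \<le> 2 * M * norm f" for f :: "'a \<Rightarrow>\<^sub>L real" and n
    by (rule suppression_1_unconditional_abs_functional_le[OF s w(5)]) simp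
  have summ: "summable (\<lambda>k. \<bar>blinfun_apply f (w k)\<bar>)" for f :: "'a \<Rightarrow>\<^sub>L real"
    by (rule summableI_nonneg_bounded[of _ "2 * M * norm f"]) (use bd in auto)
  have summ': "summable (\<lambda>k. blinfun_apply f (w k))" for f :: "'a \<Rightarrow>\<^sub>L real"
    by (rule summable_rabs_cancel[OF summ])
  have bl: "bounded_linear (\<lambda>f :: 'a \<Rightarrow>\<^sub>L real. \<Sum>k. blinfun_apply f (w k))"
  proof (rule bounded_linear_intro[of _ "2 * M"])
    fix f g :: "'a \<Rightarrow>\<^sub>L real" and c :: real
    show "(\<Sum>k. blinfun_apply (f + g) (w k)) = (\<Sum>k. blinfun_apply f (w k)) + (\<Sum>k. blinfun_apply g (w k))"
      by (simp add: blinfun.add_left suminf_add summ')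
    show "(\<Sum>k. blinfun_apply (c *\<^sub>R f) (w k)) = c *\<^sub>R (\<Sum>k. blinfun_apply f (w k))"
      using suminf_mult[OF summ'[of f], of c] by (simp add: blinfun.scaleR_left)
    have "norm (\<Sum>k. blinfun_apply f (w k)) \<le> (\<Sum>k. \<bar>blinfun_apply f (w k)\<bar>)"
      using summable_rabs[OF summ[of f]] by simp
    also have "\<dots> \<le> 2 * M * norm f" by (rule suminf_le_const[OF summ bd])
    finally show "norm (\<Sum>k. blinfun_apply f (w k)) \<le> norm f * (2 * M)" by (simp add: mult.commute)
  qed
  define \<Phi> where "\<Phi> = Blinfun (\<lambda>f :: 'a \<Rightarrow>\<^sub>L real. \<Sum>k. blinfun_apply f (w k))"
  have \<Phi>: "blinfun_apply \<Phi> f = (\<Sum>k. blinfun_apply f (w k))" for f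
    by (simp add: \<Phi>_def bounded_linear_Blinfun_apply[OF bl])
  obtain G :: "('a \<Rightarrow>\<^sub>L real) \<Rightarrow>\<^sub>L real"
    where GV: "\<forall>f\<in>closed_span (range coord_fun). blinfun_apply G f = 0" and GS: "blinfun_apply G sum_fun = 1"
    using sum_fun_separation by (elim exE conjE)
  obtain \<alpha> \<beta> x where ab: "\<alpha> \<noteq> 0 \<or> \<beta> \<noteq> 0" "\<alpha> *\<^sub>R \<Phi> + \<beta> *\<^sub>R G = canonical_embedding x"
    using quasi_reflexive_imp_dependent[OF assms, of \<Phi> G] by (elim exE conjE)
  have app: "\<alpha> * blinfun_apply \<Phi> g + \<beta> * blinfun_apply G g = blinfun_apply g x" for g
    using arg_cong[OF ab(2), of "\<lambda>F. blinfun_apply F g"] by (simp add: blinfun.add_left blinfun.scaleR_left)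
  have cx: "coord e x i = \<alpha> * coord e (w k) i" if i: "i \<in> {q k..<q (Suc k)}" for i k
  proof -
    have "blinfun_apply \<Phi> (coord_fun i) = (\<Sum>j\<in>{k}. coord e (w j) i)"
      unfolding \<Phi> coord_fun_apply by (rule suminf_finite) (use blocks_coord_other[OF w(1) i] in auto)
    then show ?thesis using app[of "coord_fun i"] bspec[OF GV coord_fun_in_closed_span[of i]] by simp
  qed
  have blk: "(\<Sum>i\<in>{q k..<q (Suc k)}. coord e x i *\<^sub>R e i) = \<alpha> *\<^sub>R w k" for k
    using blocks_eq_sum[OF w(1), of k] by (simp add: cx scaleR_sum_right[symmetric] flip: scaleR_scaleR)
  \<comment> \<open>On each interval of \<open>q\<close> the expansion of \<open>x\<close> is
    \<open>\<alpha> *\<^sub>R w k\<close>. Convergence forces these pieces to 0, but the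
    \<open>w k\<close> stay bounded below.\<close>
  have "\<alpha> = 0"
  proof (rule ccontr)
    assume "\<alpha> \<noteq> 0"
    then have pos: "\<bar>\<alpha>\<bar> * \<delta> > 0" using w(3) by simp
    obtain N where N: "\<And>m n. m \<ge> N \<Longrightarrow> norm (\<Sum>i\<in>{m..<n}. coord e x i *\<^sub>R e i) < \<bar>\<alpha>\<bar> * \<delta>"
      using sums_summable[OF sums_coord[OF basis, of x]] pos unfolding summable_Cauchy by blast
    have "N \<le> q N" using w(1) by (simp add: blocks_def strict_mono_imp_increasing)
    from N[OF this, of "q (Suc N)"] have "\<bar>\<alpha>\<bar> * norm (w N) < \<bar>\<alpha>\<bar> * \<delta>" unfolding blk by simp
    then show False using w(4)[of N] \<open>\<alpha> \<noteq> 0\<close> by simp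
  qed
  then have "coord e x i = 0" for i
    using app[of "coord_fun i"] bspec[OF GV coord_fun_in_closed_span[of i]] by simp
  then have "x = 0" by (intro eq_if_coord_eq) simp
  then show False using app[of sum_fun] \<open>\<alpha> = 0\<close> GS ab(1) by simp
qed

theorem quasi_reflexive_iff:
  "\<not> c0_embeds TYPE('a) \<and> \<not> l1_embeds TYPE('a) \<longleftrightarrow> quasi_reflexive_of_order 1 TYPE('a)"
  using boundedly_complete_iff shrinking_difference_sequence_iff shrinking_iff quasi_reflexive_if
    closed_span_eq_UNIV_if_quasi_reflexive boundedly_complete_if_quasi_reflexive by blast

end

theorem theorem2p3:
  fixes e :: "nat \<Rightarrow> 'a::banach"
  assumes "schauder_basis e"
    and "normalized e"
    and "one_spreading e"
    and "bimonotone e"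
    and "\<not> weakly_null e"
  shows
    "((\<forall>x. summable (coord e x)) \<and> bounded_linear (summing_functional e)) \<and>
     (\<forall>x. normalized x \<and> block_basis e x \<and> (\<forall>i. summing_functional e (x i) = 0)
        \<longrightarrow> suppression_1_unconditional x) \<and>
     skipped_unconditional_basis (difference_sequence e) \<and>
     (boundedly_complete e \<longleftrightarrow> \<not> c0_embeds TYPE('a)) \<and>
     (shrinking (difference_sequence e) \<longleftrightarrow> \<not> l1_embeds TYPE('a)) \<and>
     (\<not> l1_embeds TYPE('a) \<longleftrightarrow>
        direct_sum_decomposition (span {Blinfun (summing_functional e)})
          (closed_span (range (biorthogonal e)))) \<and>
     (\<not> c0_embeds TYPE('a) \<and> \<not> l1_embeds TYPE('a) \<longleftrightarrow>
        quasi_reflexive_of_order 1 TYPE('a))"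
proof -
  interpret spreading_basis e using assms by unfold_locales
  have "range (biorthogonal e) = range coord_fun" by (simp add: biorthogonal_eq)
  then have "direct_sum_decomposition (span {Blinfun (summing_functional e)}) (closed_span (range (biorthogonal e)))
      \<longleftrightarrow> \<not> l1_embeds TYPE('a)"
    using direct_sum_iff shrinking_iff shrinking_difference_sequence_iff by (simp add: sum_fun_def)
  then show ?thesis
    using summable_coord bounded_linear_summing_functional suppression_1_unconditional_block_basis
      skipped_unconditional_basis_difference_sequence boundedly_complete_iff shrinking_difference_sequence_iff
      quasi_reflexive_iff by blast
qed

end
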